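(* Let $G$ be a polynomial semigroup in $\mathcal G$ generated by a (possibly non-compact) family of polynomials of degree two. Then $J(G)$ is connected.
   Context: $\hat{\mathbb C}$ is the Riemann sphere. A polynomial semigroup is a semigroup (under composition) generated by a family of non-constant polynomial maps on $\hat{\mathbb C}$. The Fatou set $F(G)$ is the set of $z\in\hat{\mathbb C}$ having a neighborhood on which $G$ is a normal family; the Julia set is $J(G)=\hat{\mathbb C}\setminus F(G)$. $P(G)=\overline{\bigcup_{g\in G}\{\text{critical values of } g:\hat{\mathbb C}\to\hat{\mathbb C}\}}$ and $P^{*}(G)=P(G)\setminus\{\infty\}$. $\mathcal G$ is the set of polynomial semigroups $G$ all of whose elements have degree at least two and for which $P^{*}(G)$ is bounded in $\mathbb C$. *)

theory Defs
  imports "HOL-Complex_Analysis.Complex_Analysis" "HOL-Computational_Algebra.Polynomial"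
begin

text \<open>
  The Riemann sphere as the one-point compactification of the complex plane:
  \<^term>\<open>None\<close> is the point at infinity.
\<close>

type_synonym sphere = "complex option"

abbreviation riemann_sphere :: "sphere topology" where
  "riemann_sphere \<equiv> Alexandroff_compactification (euclidean :: complex topology)"

text \<open>
  Inverse stereographic projection onto the unit sphere of \<open>\<complex> \<times> \<real>\<close>, infinity going to the north
  pole. The distance it induces on the sphere is the chordal metric
  \<open>2 |z - w| / (sqrt (1 + |z|\<^sup>2) sqrt (1 + |w|\<^sup>2))\<close>.
\<close>

definition stereo :: "sphere \<Rightarrow> complex \<times> real" where
  "stereo x = (case x of
      None \<Rightarrow> (0, 1)
    | Some z \<Rightarrow> (of_real (2 / ((cmod z)\<^sup>2 + 1)) * z, ((cmod z)\<^sup>2 - 1) / ((cmod z)\<^sup>2 + 1)))"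


subsection \<open>Polynomial maps and polynomial semigroups\<close>

text \<open>
  The holomorphic self-map of the sphere given by a polynomial; non-constant polynomials fix infinity.
\<close>

definition poly_map :: "complex poly \<Rightarrow> sphere \<Rightarrow> sphere" where
  "poly_map p x = (case x of
      None \<Rightarrow> if degree p = 0 then Some (coeff p 0) else None
    | Some z \<Rightarrow> Some (poly p z))"

inductive_set comp_semigroup :: "('a \<Rightarrow> 'a) set \<Rightarrow> ('a \<Rightarrow> 'a) set"
  for S :: "('a \<Rightarrow> 'a) set" where
  generator: "f \<in> S \<Longrightarrow> f \<in> comp_semigroup S"
| comp: "f \<in> comp_semigroup S \<Longrightarrow> g \<in> comp_semigroup S \<Longrightarrow> f \<circ> g \<in> comp_semigroup S"

definition polynomial_semigroup :: "(sphere \<Rightarrow> sphere) set \<Rightarrow> bool" where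
  "polynomial_semigroup G \<longleftrightarrow>
     (\<exists>\<Gamma>. (\<forall>p\<in>\<Gamma>. degree p \<noteq> 0) \<and> G = comp_semigroup (poly_map ` \<Gamma>))"


subsection \<open>Fatou and Julia sets\<close>

text \<open>
  Every sequence in the family has a subsequence converging, in the chordal metric, uniformly on
  compact subsets of \<open>U\<close> to some map into the sphere.
\<close>

definition normal_family_on :: "sphere set \<Rightarrow> (sphere \<Rightarrow> sphere) set \<Rightarrow> bool" where
  "normal_family_on U F \<longleftrightarrow>
     (\<forall>f :: nat \<Rightarrow> sphere \<Rightarrow> sphere. range f \<subseteq> F \<longrightarrow>
        (\<exists>r h. strict_mono r \<and>
           (\<forall>K. compactin riemann_sphere K \<and> K \<subseteq> U \<longrightarrow>
              uniform_limit K (\<lambda>n x. stereo (f (r n) x)) (\<lambda>x. stereo (h x)) sequentially)))"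

definition Fatou :: "(sphere \<Rightarrow> sphere) set \<Rightarrow> sphere set" where
  "Fatou G = {x. \<exists>U. openin riemann_sphere U \<and> x \<in> U \<and> normal_family_on U G}"

definition Julia :: "(sphere \<Rightarrow> sphere) set \<Rightarrow> sphere set" where
  "Julia G = UNIV - Fatou G"


subsection \<open>Critical values and the postcritical set\<close>

text \<open>
  Local coordinates centred at a point: \<open>z - a\<close> at a finite point \<open>a\<close>, and \<open>1 / z\<close> at infinity.
  \<open>local_coord x\<close> is only meaningful near \<open>x\<close>; its value at the other centre is a dummy.
\<close>

definition local_coord :: "sphere \<Rightarrow> sphere \<Rightarrow> complex" where
  "local_coord x y = (case x of
      None \<Rightarrow> (case y of None \<Rightarrow> 0 | Some z \<Rightarrow> inverse z)
    | Some a \<Rightarrow> (case y of None \<Rightarrow> 0 | Some z \<Rightarrow> z - a))"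

definition local_param :: "sphere \<Rightarrow> complex \<Rightarrow> sphere" where
  "local_param x w = (case x of
      None \<Rightarrow> (if w = 0 then None else Some (inverse w))
    | Some a \<Rightarrow> Some (a + w))"

definition critical_point :: "(sphere \<Rightarrow> sphere) \<Rightarrow> sphere \<Rightarrow> bool" where
  "critical_point g x \<longleftrightarrow>
     ((\<lambda>w. local_coord (g x) (g (local_param x w))) has_field_derivative 0) (at 0)"

definition critical_values :: "(sphere \<Rightarrow> sphere) \<Rightarrow> sphere set" where
  "critical_values g = g ` {x. critical_point g x}"

definition postcritical_set :: "(sphere \<Rightarrow> sphere) set \<Rightarrow> sphere set" where
  "postcritical_set G = riemann_sphere closure_of (\<Union>g\<in>G. critical_values g)"

definition finite_postcritical_set :: "(sphere \<Rightarrow> sphere) set \<Rightarrow> sphere set" where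
  "finite_postcritical_set G = postcritical_set G - {None}"

text \<open>Postcritically bounded polynomial semigroups (the class usually denoted by a calligraphic G).\<close>

definition pcb_semigroups :: "(sphere \<Rightarrow> sphere) set set" where
  "pcb_semigroups = {G. polynomial_semigroup G \<and>
     (\<forall>g\<in>G. \<exists>p. g = poly_map p \<and> degree p \<ge> 2) \<and>
     bounded {z. Some z \<in> finite_postcritical_set G}}"

end

theory Submission
  imports Defs "HOL-Computational_Algebra.Fundamental_Theorem_Algebra"
begin

text \<open>
  For a generator \<open>h\<close> and a word \<open>w\<close> in the generators let \<open>K(w, h)\<close> be the preimage under \<open>w\<close> of
  the filled Julia set of \<open>h\<close>. Postcritical boundedness makes it connected with connected
  complement, so its frontier \<open>L(w, h)\<close> is a continuum. It lies in the Julia set \<open>J\<close>, and, by Montel's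
  theorem for maps omitting three points of \<open>L([], h)\<close>, for fixed \<open>h\<close> the union of all \<open>L(w, h)\<close> is dense
  in \<open>J\<close>. Hence if \<open>J\<close> splits into two closed parts, each \<open>L(w, h)\<close> lies in one of them, and it
  suffices that all lie in the same one.

  Writing \<open>h w\<close> for "first \<open>w\<close>, then \<open>h\<close>", we have \<open>L(h w, h) = L(w, h)\<close>. Because the degrees are
  two, \<open>K(h1 w, h2)\<close> and \<open>K(h2 w, h1)\<close> have equal logarithmic capacity, so neither is interior to the
  other, and \<open>L(h1 w, h2)\<close> meets \<open>L(h2 w, h1)\<close>. If \<open>L(w, h1)\<close> and \<open>L(w, h2)\<close> were in different
  parts, these two facts would give arbitrarily long words \<open>v w\<close> with the same property; then one of
  \<open>K(v w, h1)\<close>, \<open>K(v w, h2)\<close> lies in the other with a margin bounded below, although the ratio of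
  their capacities tends to \<open>1\<close>. So the part containing \<open>L(w, h)\<close> does not depend on \<open>h\<close>, and by
  \<open>L(h w, h) = L(w, h)\<close> it does not depend on \<open>w\<close> either.
\<close>

subsection \<open>Polynomial sublevel sets\<close>

lemma compact_poly_sublevel:
  fixes p :: "complex poly"
  assumes "degree p > 0"
  shows "compact {z. cmod (poly p z) \<le> r}"
proof -
  obtain a q where p: "p = pCons a q" "q \<noteq> 0"
    using assms by (cases p) (auto split: if_splits)
  obtain s where s: "\<And>z. s \<le> cmod z \<Longrightarrow> r + 1 \<le> cmod (poly p z)"
    using poly_infinity[OF \<open>q \<noteq> 0\<close>, of "r + 1" a] p by auto
  have "{z. cmod (poly p z) \<le> r} \<subseteq> cball 0 s"
    using s by (auto simp: not_le[symmetric]) (smt (verit))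
  moreover have "closed {z. cmod (poly p z) \<le> r}"
    by (intro closed_Collect_le continuous_intros)
  ultimately show ?thesis
    using bounded_cball bounded_subset compact_eq_bounded_closed by blast
qed

text \<open>The maximum modulus principle for \<open>Q / P\<close> outside the sublevel set; reflecting the
  polynomials moves infinity to \<open>0\<close>, and the zero of \<open>P\<close> at \<open>0\<close> makes the reflected domain bounded.\<close>

lemma lead_coeff_le_of_sublevel_subset_root_0:
  fixes P Q :: "complex poly"
  assumes deg: "degree Q = degree P" and P: "P \<noteq> 0" "poly P 0 = 0" and r: "r > 0"
    and sub: "\<And>z. cmod (poly P z) \<le> r \<Longrightarrow> cmod (poly Q z) \<le> r"
  shows "cmod (lead_coeff Q) \<le> cmod (lead_coeff P)"
proof -
  define D where "D = degree P"
  have D: "D > 0"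
    using P unfolding D_def by (cases P) (auto split: if_splits)
  \<comment> \<open>With \<open>w = 1 / z\<close> and denominators cleared this is the exterior
    \<open>r < cmod (poly P z)\<close>. It contains \<open>w = 0\<close>, where the reflected
    polynomials take the leading coefficients as values; so \<open>f 0\<close> is their
    quotient.\<close>
  define S where "S = {w. r * cmod w ^ D < cmod (poly (reflect_poly P) w)}"
  define f where "f = (\<lambda>w. poly (reflect_poly Q) w / poly (reflect_poly P) w)"
  have refl: "cmod (poly (reflect_poly p) w) = cmod w ^ D * cmod (poly p (inverse w))"
    if "w \<noteq> 0" "degree p = D" for p w
    using that by (simp add: poly_reflect_poly_nz norm_mult norm_power)
  have "open S"
    unfolding S_def by (intro open_Collect_less continuous_intros)
  have "0 \<in> S"
    using P D by (simp add: S_def power_0_left)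
  have clS: "closure S \<subseteq> {w. r * cmod w ^ D \<le> cmod (poly (reflect_poly P) w)}"
  proof (rule closure_minimal)
    show "closed {w. r * cmod w ^ D \<le> cmod (poly (reflect_poly P) w)}"
      by (intro closed_Collect_le continuous_intros)
  qed (auto simp: S_def)
  have nz: "poly (reflect_poly P) w \<noteq> 0" if "w \<in> closure S" for w
  proof (cases "w = 0")
    case False
    have "0 < r * cmod w ^ D"
      using False r by simp
    then show ?thesis
      using that clS by fastforce
  qed (use P in simp)
  obtain d where d: "d > 0" "\<And>z. cmod z < d \<Longrightarrow> cmod (poly P z) < r"
  proof -
    have "continuous (at 0) (poly P)"
      by (intro continuous_intros)
    then show ?thesis
      using that P r unfolding continuous_at_eps_delta by (auto simp: dist_norm)
  qed
  have "S \<subseteq> cball 0 (1 / d)"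
  proof
    fix w assume w: "w \<in> S"
    show "w \<in> cball 0 (1 / d)"
    proof (cases "w = 0")
      case False
      have "r * cmod w ^ D < cmod w ^ D * cmod (poly P (inverse w))"
        using w refl[OF False, of P] by (simp add: S_def D_def)
      then have "r < cmod (poly P (inverse w))"
        using False by (simp add: mult.commute)
      then have "\<not> cmod (inverse w) < d"
        using d(2) by force
      then show ?thesis
        using False d(1) by (simp add: norm_inverse norm_divide field_simps not_less)
    qed (use d in simp)
  qed
  then have "bounded S"
    using bounded_cball bounded_subset by blast
  have "cmod (f 0) \<le> 1"
  proof (rule maximum_modulus_frontier[of f S])
    show "f holomorphic_on interior S"
      unfolding f_def using nz closure_subset interior_subset
      by (intro holomorphic_intros) blast
    show "continuous_on (closure S) f"
      unfolding f_def using nz by (intro continuous_intros) blast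
    show "bounded S" "0 \<in> S"
      by fact+
    fix w assume "w \<in> frontier S"
    then have "w \<in> closure S" "w \<notin> S"
      using \<open>open S\<close> by (auto simp: frontier_def interior_open)
    then have eq: "cmod (poly (reflect_poly P) w) = r * cmod w ^ D"
      using clS by (force simp: S_def)
    have "w \<noteq> 0"
      using \<open>0 \<in> S\<close> \<open>w \<notin> S\<close> by auto
    then have "cmod (poly P (inverse w)) = r"
      using eq refl[of w P] by (simp add: D_def)
    then have "cmod (poly Q (inverse w)) \<le> r"
      using sub by simp
    then have "cmod (poly (reflect_poly Q) w) \<le> cmod (poly (reflect_poly P) w)"
      using eq refl[OF \<open>w \<noteq> 0\<close>, of Q] deg by (simp add: D_def mult.commute[of r] mult_left_mono)
    then show "cmod (f w) \<le> 1"
      using nz[OF \<open>w \<in> closure S\<close>] by (simp add: f_def norm_divide)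
  qed
  then show ?thesis
    using P by (simp add: f_def norm_divide)
qed

text \<open>Translating a root of \<open>P\<close> to \<open>0\<close> preserves degrees and leading
  coefficients, which reduces this to the previous case.\<close>

lemma lead_coeff_le_of_sublevel_subset:
  fixes P Q :: "complex poly"
  assumes deg: "degree Q = degree P" and "degree P > 0" and r: "r > 0"
    and sub: "\<And>z. cmod (poly P z) \<le> r \<Longrightarrow> cmod (poly Q z) \<le> r"
  shows "cmod (lead_coeff Q) \<le> cmod (lead_coeff P)"
proof -
  obtain b where b: "poly P b = 0"
    using fundamental_theorem_of_algebra[of P] \<open>degree P > 0\<close> constant_degree by force
  define T where "T = [:b, 1:]"
  have T: "degree T = 1" "lead_coeff T = 1"
    by (auto simp: T_def)
  have "cmod (lead_coeff (pcompose Q T)) \<le> cmod (lead_coeff (pcompose P T))"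
  proof (rule lead_coeff_le_of_sublevel_subset_root_0)
    show "degree (Q \<circ>\<^sub>p T) = degree (P \<circ>\<^sub>p T)"
      by (simp only: degree_pcompose deg)
    have "degree (P \<circ>\<^sub>p T) > 0"
      using assms(2) T by (simp add: degree_pcompose)
    then show "P \<circ>\<^sub>p T \<noteq> 0"
      by auto
  qed (use r sub b in \<open>auto simp: poly_pcompose T_def\<close>)
  then show ?thesis
    using T by (simp add: lead_coeff_comp)
qed

subsection \<open>Filled Julia sets and their capacity\<close>

definition iterp :: "complex poly \<Rightarrow> nat \<Rightarrow> complex poly \<Rightarrow> complex poly" where
  "iterp h n f = ((\<circ>\<^sub>p) h ^^ n) f"

text \<open>For \<open>f = [:0, 1:]\<close> this is the usual filled Julia set of \<open>h\<close>;
  in general it is the preimage of that set under \<open>f\<close>.\<close>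

definition filled :: "complex poly \<Rightarrow> complex poly \<Rightarrow> complex set" where
  "filled h f = {z. bounded (range (\<lambda>n. poly (iterp h n f) z))}"

text \<open>Doubling makes an orbit that leaves the disc grow geometrically. The condition survives
  enlarging \<open>r\<close>, so two polynomials can share a radius.\<close>

definition escape_radius :: "complex poly \<Rightarrow> real \<Rightarrow> bool" where
  "escape_radius h r \<longleftrightarrow> r > 0 \<and> (\<forall>z. r < cmod z \<longrightarrow> 2 * cmod z \<le> cmod (poly h z))"

lemma iterp_0 [simp]: "iterp h 0 f = f"
  and iterp_Suc: "iterp h (Suc n) f = h \<circ>\<^sub>p iterp h n f"
  by (simp_all add: iterp_def)

lemma iterp_Suc2: "iterp h (Suc n) f = iterp h n (h \<circ>\<^sub>p f)"
  by (simp add: iterp_def funpow_swap1)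

lemma iterp_pcompose: "iterp h n (f \<circ>\<^sub>p g) = iterp h n f \<circ>\<^sub>p g"
  by (induction n) (simp_all add: iterp_Suc pcompose_assoc)

lemma degree_iterp: "degree (iterp h n f) = degree h ^ n * degree f"
  by (induction n) (simp_all add: iterp_Suc degree_pcompose)

text \<open>With \<open>a = lead_coeff h\<close>, one more iterate turns a leading coefficient
  \<open>l\<close> into \<open>a * l^2\<close>, so \<open>a * l\<close> is squared.\<close>

lemma lead_coeff_iterp:
  assumes "degree h = 2" "degree f > 0"
  shows "lead_coeff h * lead_coeff (iterp h n f) = (lead_coeff h * lead_coeff f) ^ 2 ^ n"
proof (induction n)
  case (Suc n)
  have "degree (iterp h n f) > 0"
    using assms by (simp add: degree_iterp)
  then have "lead_coeff h * lead_coeff (iterp h (Suc n) f)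
      = (lead_coeff h * lead_coeff (iterp h n f)) ^ 2"
    using assms by (simp add: iterp_Suc lead_coeff_comp power2_eq_square)
  then show ?case
    using Suc by (simp add: power_mult[symmetric] mult.commute)
qed simp

lemma escape_radius_mono: "escape_radius h r \<Longrightarrow> r \<le> s \<Longrightarrow> escape_radius h s"
  by (auto simp: escape_radius_def)

lemma escape_radius_exists:
  assumes "degree h = 2"
  obtains r where "escape_radius h r"
proof -
  define c b a where "c = coeff h 0" and "b = coeff h 1" and "a = coeff h 2"
  have "a \<noteq> 0"
    using assms leading_coeff_neq_0[of h] by (force simp: a_def)
  have h: "poly h z = c + z * (b + a * z)" for z
    using assms by (simp add: poly_altdef c_def b_def a_def numeral_2_eq_2 algebra_simps power2_eq_square)
  \<comment> \<open>The second entry forces \<open>cmod (b + a * z) \<ge> 2 + cmod c\<close>; the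
    first lets \<open>cmod z * cmod c\<close> absorb the constant term.\<close>
  define r where "r = max 1 ((2 + cmod b + cmod c) / cmod a)"
  have "2 * cmod z \<le> cmod (poly h z)" if "r < cmod z" for z
  proof -
    have z: "cmod z > 1" "cmod a * cmod z \<ge> 2 + cmod b + cmod c"
      using that \<open>a \<noteq> 0\<close> by (auto simp: r_def field_simps)
    have "cmod (a * z) \<le> cmod (b + a * z) + cmod b"
      by (metis add_diff_cancel_left' norm_triangle_sub norm_triangle_ineq4 add.commute)
    then have "2 + cmod c \<le> cmod (b + a * z)"
      using z by (simp add: norm_mult)
    then have "cmod z * (2 + cmod c) \<le> cmod (z * (b + a * z))"
      by (simp add: norm_mult mult_left_mono)
    moreover have "cmod (z * (b + a * z)) \<le> cmod (poly h z) + cmod c"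
      unfolding h by (metis add_diff_cancel_left' norm_triangle_ineq4)
    moreover have "cmod c \<le> cmod z * cmod c"
      using z mult_right_mono[of 1 "cmod z" "cmod c"] by simp
    ultimately show ?thesis
      by (simp add: algebra_simps)
  qed
  then show ?thesis
    by (intro that[of r]) (auto simp: escape_radius_def r_def)
qed

lemma escape_growth:
  assumes "escape_radius h r" "r < cmod (poly (iterp h m f) z)"
  shows "2 ^ k * r \<le> cmod (poly (iterp h (m + k) f) z) \<and> r < cmod (poly (iterp h (m + k) f) z)"
proof (induction k)
  case (Suc k)
  have "2 * cmod (poly (iterp h (m + k) f) z) \<le> cmod (poly (iterp h (m + Suc k) f) z)"
    using assms(1) Suc by (simp add: escape_radius_def iterp_Suc poly_pcompose)
  then show ?case
    using Suc assms(1) by (auto simp: escape_radius_def)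
qed (use assms in auto)

lemma escape_tendsto_infinity:
  assumes "escape_radius h r" "r < cmod (poly (iterp h m f) z)"
  shows "filterlim (\<lambda>n. cmod (poly (iterp h n f) z)) at_top sequentially"
proof -
  have "r > 0"
    using assms by (simp add: escape_radius_def)
  have "filterlim (\<lambda>k. (2::real) ^ k * r) at_top sequentially"
    using \<open>r > 0\<close> by real_asymp
  then have "filterlim (\<lambda>k. cmod (poly (iterp h (m + k) f) z)) at_top sequentially"
    by (rule filterlim_at_top_mono) (use escape_growth[OF assms] in simp)
  then show ?thesis
    unfolding filterlim_at_top eventually_sequentially
    by (metis le_add_diff_inverse le_diff_conv2 add.commute le_add1 order_trans)
qed

text \<open>An orbit that leaves the escape disc once tends to infinity, so every bounded orbit has
  the same bound \<open>r\<close>.\<close>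

lemma filled_eq:
  assumes "escape_radius h r"
  shows "filled h f = {z. \<forall>n. cmod (poly (iterp h n f) z) \<le> r}"
proof (intro equalityI subsetI CollectI allI)
  fix z n assume z: "z \<in> filled h f"
  show "cmod (poly (iterp h n f) z) \<le> r"
  proof (rule ccontr)
    assume "\<not> ?thesis"
    then have lim: "filterlim (\<lambda>n. cmod (poly (iterp h n f) z)) at_top sequentially"
      using escape_tendsto_infinity[OF assms] by (simp add: not_le)
    obtain B where "\<And>n. cmod (poly (iterp h n f) z) \<le> B"
      using z by (auto simp: filled_def bounded_iff)
    moreover have "\<forall>\<^sub>F n in sequentially. cmod (poly (iterp h n f) z) \<ge> B + 1"
      using lim by (simp add: filterlim_at_top)
    ultimately show False
      by (metis (mono_tags, lifting) add_le_same_cancel1 eventually_happens' not_one_le_zero order_trans trivial_limit_sequentially)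
  qed
qed (auto simp: filled_def bounded_iff)

lemma filled_sublevel_decseq:
  assumes "escape_radius h r" "m \<le> n"
  shows "{z. cmod (poly (iterp h n f) z) \<le> r} \<subseteq> {z. cmod (poly (iterp h m f) z) \<le> r}"
  using escape_growth[OF assms(1), of m f _ "n - m"] assms(2) by (fastforce simp: not_le[symmetric])

lemma filled_eq_Inter:
  assumes "escape_radius h r"
  shows "filled h f = (\<Inter>n. {z. cmod (poly (iterp h n f) z) \<le> r})"
  using filled_eq[OF assms] by auto

text \<open>The orbits started at \<open>f\<close> and at \<open>h \<circ> f\<close> differ only in
  their first term.\<close>

lemma filled_pcompose_self: "filled h (h \<circ>\<^sub>p f) = filled h f"
proof -
  have "range (\<lambda>n. poly (iterp h n f) z) = insert (poly f z) (range (\<lambda>n. poly (iterp h n (h \<circ>\<^sub>p f)) z))" for z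
    by (auto simp: iterp_Suc2[symmetric] image_iff simp del: iterp_0)
       (metis iterp_0 not0_implies_Suc, metis iterp_0)
  then show ?thesis
    by (simp add: filled_def)
qed

lemma compact_filled:
  assumes "degree h = 2" "degree f > 0"
  shows "compact (filled h f)"
proof -
  obtain r where r: "escape_radius h r"
    using escape_radius_exists assms by blast
  show ?thesis
    unfolding filled_eq_Inter[OF r] using assms
    by (intro compact_Inter) (auto intro!: compact_poly_sublevel simp: degree_iterp)
qed

text \<open>A bounded component of the complement has its frontier in the filled set, where every
  iterate has modulus at most \<open>r\<close>. By the maximum modulus principle the bound holds
  inside too, so the component would belong to the filled set.\<close>

lemma connected_Compl_filled:
  assumes "degree h = 2" "degree f > 0"
  shows "connected (- filled h f)"
proof (rule ccontr)
  assume "\<not> connected (- filled h f)"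
  moreover have cp: "compact (filled h f)"
    using assms by (rule compact_filled)
  ultimately obtain C where C: "C \<in> components (- filled h f)" "bounded C"
    using cobounded_has_bounded_component[of "- filled h f"] by (auto simp: compact_imp_bounded)
  obtain r where r: "escape_radius h r"
    using escape_radius_exists assms by blast
  obtain x where "x \<in> C"
    using C in_components_nonempty by blast
  have "cmod (poly (iterp h n f) x) \<le> r" for n
  proof (rule maximum_modulus_frontier[of "poly (iterp h n f)" C])
    show "cmod (poly (iterp h n f) z) \<le> r" if "z \<in> frontier C" for z
      using that frontier_of_components_closed_complement[OF compact_imp_closed[OF cp] C(1)]
        filled_eq[OF r] by blast
  qed (use C \<open>x \<in> C\<close> in \<open>auto intro!: continuous_intros holomorphic_intros\<close>)
  then have "x \<in> filled h f"
    using filled_eq[OF r] by blast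
  then show False
    using \<open>x \<in> C\<close> C in_components_subset by blast
qed

lemma filled_sublevel_eventually_subset:
  assumes "degree h = 2" "degree f > 0" "escape_radius h r" "open U" "filled h f \<subseteq> U"
  obtains N where "\<And>n. n \<ge> N \<Longrightarrow> {z. cmod (poly (iterp h n f) z) \<le> r} \<subseteq> U"
proof -
  let ?S = "\<lambda>n. {z. cmod (poly (iterp h n f) z) \<le> r}"
  have comp: "compact (?S n)" for n
    using assms by (intro compact_poly_sublevel) (simp add: degree_iterp)
  have "\<exists>N. ?S N - U = {}"
  proof (rule ccontr)
    assume "\<nexists>N. ?S N - U = {}"
    then have "\<Inter> (range (\<lambda>n. ?S n - U)) \<noteq> {}"
      using comp \<open>open U\<close> filled_sublevel_decseq[OF assms(3)]
      by (intro compact_nest) (blast intro: compact_diff)+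
    then show False
      using filled_eq_Inter[OF assms(3), of f] assms(5) by auto
  qed
  then show ?thesis
    using that filled_sublevel_decseq[OF assms(3)] by (metis Diff_eq_empty_iff subset_trans)
qed

section \<open>Monotonicity of capacity, with and without a margin\<close>

lemma power_power2_unbounded:
  fixes q :: real
  assumes "q > 1"
  obtains n where "n \<ge> N" "B < q ^ 2 ^ n"
proof -
  obtain k where k: "B < q ^ k"
    using real_arch_pow assms by blast
  have "k \<le> 2 ^ max N k"
    using less_exp[of "max N k"] by linarith
  then have "q ^ k \<le> q ^ 2 ^ max N k"
    using assms by (simp add: power_increasing)
  then show ?thesis
    using that[of "max N k"] k by simp
qed

text \<open>The product of leading coefficients has modulus \<open>c\<close> to the power \<open>- degree f\<close>, where \<open>c\<close> is the
  logarithmic capacity of \<open>filled h f\<close>; so this is monotonicity of capacity.\<close>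

lemma capacity_mono:
  assumes h: "degree h1 = 2" "degree h2 = 2" and deg: "degree g = degree f" "degree f > 0"
    and U: "open U" "filled h1 f \<subseteq> U" "U \<subseteq> filled h2 g"
  shows "cmod (lead_coeff h2 * lead_coeff g) \<le> cmod (lead_coeff h1 * lead_coeff f)"
proof (rule ccontr)
  assume less: "\<not> ?thesis"
  obtain r1 r2 where "escape_radius h1 r1" "escape_radius h2 r2"
    using escape_radius_exists h by metis
  then obtain r where r: "escape_radius h1 r" "escape_radius h2 r"
    by (meson escape_radius_mono max.cobounded1 max.cobounded2)
  obtain N where N: "\<And>n. n \<ge> N \<Longrightarrow> {z. cmod (poly (iterp h1 n f) z) \<le> r} \<subseteq> U"
    using filled_sublevel_eventually_subset[OF h(1) deg(2) r(1) U(1,2)] by blast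
  let ?x = "cmod (lead_coeff h1 * lead_coeff f)" and ?y = "cmod (lead_coeff h2 * lead_coeff g)"
  have a: "cmod (lead_coeff h1) > 0" "cmod (lead_coeff h2) > 0" "?x > 0"
  proof -
    have "h1 \<noteq> 0" "h2 \<noteq> 0" "f \<noteq> 0"
      using h deg by auto
    then show "cmod (lead_coeff h1) > 0" "cmod (lead_coeff h2) > 0" "?x > 0"
      by simp_all
  qed
  \<comment> \<open>Comparing the \<open>n\<close>-th sublevel sets compares \<open>2 ^ n\<close>-th
    powers up to a fixed factor; a ratio above \<open>1\<close> would make these powers
    unbounded.\<close>
  have bound: "(?y / ?x) ^ 2 ^ n \<le> cmod (lead_coeff h2) / cmod (lead_coeff h1)" if "n \<ge> N" for n
  proof -
    have "cmod (lead_coeff (iterp h2 n g)) \<le> cmod (lead_coeff (iterp h1 n f))"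
    proof (rule lead_coeff_le_of_sublevel_subset)
      show "cmod (poly (iterp h2 n g) z) \<le> r" if "cmod (poly (iterp h1 n f) z) \<le> r" for z
        using that N[OF \<open>n \<ge> N\<close>] U(3) filled_eq[OF r(2)] by blast
    qed (use h deg r in \<open>auto simp: degree_iterp escape_radius_def\<close>)
    then have "cmod (lead_coeff h1) * (cmod (lead_coeff h2) * cmod (lead_coeff (iterp h2 n g)))
        \<le> cmod (lead_coeff h2) * (cmod (lead_coeff h1) * cmod (lead_coeff (iterp h1 n f)))"
      using a by (simp add: mult.left_commute)
    then have "cmod (lead_coeff h1) * ?y ^ 2 ^ n \<le> cmod (lead_coeff h2) * ?x ^ 2 ^ n"
      using h deg by (metis lead_coeff_iterp norm_mult norm_power)
    then show ?thesis
      using a by (simp add: power_divide field_simps)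
  qed
  have "1 < ?y / ?x"
    using less a(3) by (simp only: not_le less_divide_eq_1_pos)
  then obtain n where "n \<ge> N" "cmod (lead_coeff h2) / cmod (lead_coeff h1) < (?y / ?x) ^ 2 ^ n"
    by (rule power_power2_unbounded)
  then show False
    using bound[of n] by linarith
qed

text \<open>The homothety about \<open>p\<close> with ratio \<open>1 + \<delta> / (2 * M)\<close>
  moves points of \<open>filled h1 f\<close> by at most \<open>\<delta> / 2\<close>, so the enlarged
  set still fits into the open \<open>\<delta>\<close>-neighbourhood. Precomposing with the inverse
  homothety \<open>T\<close> divides the leading coefficient of \<open>f\<close> by the ratio to the
  power \<open>degree f\<close>.\<close>

lemma capacity_mono_strict:
  assumes h: "degree h1 = 2" "degree h2 = 2" and deg: "degree g = degree f" "degree f > 0"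
    and \<delta>: "\<delta> > 0" "\<And>z y. z \<in> filled h1 f \<Longrightarrow> dist z y < \<delta> \<Longrightarrow> y \<in> filled h2 g"
    and M: "M > 0" "filled h1 f \<subseteq> cball p M"
  shows "cmod (lead_coeff h2 * lead_coeff g) * (1 + \<delta> / (2 * M)) ^ degree f
    \<le> cmod (lead_coeff h1 * lead_coeff f)"
proof -
  define \<mu> where "\<mu> = 1 + \<delta> / (2 * M)"
  have \<mu>: "\<mu> > 1"
    using \<delta> M by (simp add: \<mu>_def)
  define T where "T = [:p - p / of_real \<mu>, 1 / of_real \<mu>:]"
  have T: "degree T = 1" "lead_coeff T = 1 / of_real \<mu>" and polyT: "\<And>y. poly T y = p + (y - p) / of_real \<mu>"
    using \<mu> by (auto simp: T_def field_simps)
  have "cmod (lead_coeff h2 * lead_coeff g) \<le> cmod (lead_coeff h1 * lead_coeff (f \<circ>\<^sub>p T))"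
  proof (rule capacity_mono)
    show "degree g = degree (f \<circ>\<^sub>p T)" "degree (f \<circ>\<^sub>p T) > 0"
      using deg T by (simp_all add: degree_pcompose)
    show "open (\<Union>z\<in>filled h1 f. ball z \<delta>)"
      by auto
    show "(\<Union>z\<in>filled h1 f. ball z \<delta>) \<subseteq> filled h2 g"
      using \<delta>(2) by auto
    show "filled h1 (f \<circ>\<^sub>p T) \<subseteq> (\<Union>z\<in>filled h1 f. ball z \<delta>)"
    proof
      fix y assume "y \<in> filled h1 (f \<circ>\<^sub>p T)"
      then have z: "poly T y \<in> filled h1 f"
        by (simp add: filled_def iterp_pcompose poly_pcompose)
      have "y - poly T y = of_real (\<mu> - 1) * (poly T y - p)"
        using \<mu> by (simp add: polyT field_simps)
      then have "dist (poly T y) y = (\<mu> - 1) * dist p (poly T y)"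
        using \<mu> by (metis abs_of_pos diff_gt_0_iff_gt dist_commute dist_norm norm_mult norm_of_real)
      also have "\<dots> \<le> (\<mu> - 1) * M"
        using z M \<mu> by (intro mult_left_mono) auto
      also have "\<dots> < \<delta>"
        using M \<delta> by (simp add: \<mu>_def)
      finally show "y \<in> (\<Union>z\<in>filled h1 f. ball z \<delta>)"
        using z by auto
    qed
  qed fact+
  also have "\<dots> = cmod (lead_coeff h1 * lead_coeff f) / \<mu> ^ degree f"
    using T \<mu> by (simp add: lead_coeff_comp norm_mult norm_power power_divide norm_divide)
  finally show ?thesis
    using \<mu> unfolding \<mu>_def[symmetric] by (simp add: field_simps)
qed

text \<open>If \<open>K1\<close> is not inside \<open>K2\<close>, it meets
  \<open>frontier K2\<close>, which is connected and disjoint from \<open>frontier K1\<close> and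
  hence lies in \<open>K1\<close>. Then the connected complement of \<open>K1\<close> misses
  \<open>frontier K2\<close>; being unbounded, it lies outside \<open>K2\<close>.\<close>

lemma nested_of_separated_frontiers:
  fixes K1 K2 :: "'a :: euclidean_space set"
  assumes "compact K1" "compact K2" "connected K1" "connected (- K1)" "connected (frontier K2)"
    and ne: "K1 \<inter> K2 \<noteq> {}" and \<delta>: "\<delta> > 0"
    and sep: "\<And>x y. x \<in> frontier K1 \<Longrightarrow> y \<in> frontier K2 \<Longrightarrow> \<delta> \<le> dist x y"
  shows "(\<forall>z\<in>K1. ball z \<delta> \<subseteq> K2) \<or> (\<forall>z\<in>K2. ball z \<delta> \<subseteq> K1)"
proof -
  \<comment> \<open>A segment shorter than \<open>\<delta>\<close> from \<open>A\<close> to a point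
    outside \<open>B\<close> meets \<open>frontier B\<close> at some \<open>y'\<close>, and its
    piece before \<open>y'\<close> meets \<open>frontier A\<close>: two frontier points too close
    together.\<close>
  have room: "y \<in> B" if "A \<subseteq> B" "closed A" "closed B" "z \<in> A" "dist z y < \<delta>"
      and sep': "\<And>x y. x \<in> frontier A \<Longrightarrow> y \<in> frontier B \<Longrightarrow> \<delta> \<le> dist x y"
    for A B :: "'a set" and z y
  proof (rule ccontr)
    assume "y \<notin> B"
    then obtain y' where y': "y' \<in> closed_segment z y" "y' \<in> frontier B"
      using connected_Int_frontier[of "closed_segment z y" B] \<open>A \<subseteq> B\<close> \<open>z \<in> A\<close> by auto
    have zy': "dist z y' < \<delta>"
      using y'(1) \<open>dist z y < \<delta>\<close> dist_in_closed_segment[of y' z y] by (simp add: dist_commute)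
    have "y' \<notin> A"
    proof
      assume "y' \<in> A"
      moreover have "y' \<notin> interior A"
        using y'(2) interior_mono[OF \<open>A \<subseteq> B\<close>] by (auto simp: frontier_def)
      ultimately have "y' \<in> frontier A"
        using \<open>closed A\<close> by (simp add: frontier_def)
      then show False
        using sep'[OF _ y'(2)] \<delta> by fastforce
    qed
    then obtain x' where x': "x' \<in> closed_segment z y'" "x' \<in> frontier A"
      using connected_Int_frontier[of "closed_segment z y'" A] \<open>z \<in> A\<close> by auto
    have "dist x' y' \<le> dist z y'"
      using x'(1) dist_in_closed_segment[of x' z y'] by (simp add: dist_commute)
    then show False
      using sep'[OF x'(2) y'(2)] zy' by simp
  qed
  have cl: "closed K1" "closed K2"
    using assms compact_imp_closed by auto
  consider "K1 \<subseteq> K2" | "\<not> K1 \<subseteq> K2"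
    by blast
  then show ?thesis
  proof cases
    case 1
    then show ?thesis
      using room[OF 1 cl] sep by auto
  next
    case 2
    then obtain x where x: "x \<in> K1" "x \<in> frontier K2"
      using connected_Int_frontier[of K1 K2] assms by blast
    have disj: "frontier K1 \<inter> frontier K2 = {}"
      using sep \<delta> by fastforce
    then have "frontier K2 \<subseteq> K1"
      using connected_Int_frontier[of "frontier K2" K1] x assms(5) by blast
    then have "- K1 \<inter> frontier K2 = {}"
      by blast
    moreover have "- K1 - K2 \<noteq> {}"
    proof -
      have "bounded (K1 \<union> K2)"
        using assms by (simp add: compact_imp_bounded)
      then have "K1 \<union> K2 \<noteq> UNIV"
        using not_bounded_UNIV by metis
      then show ?thesis
        by blast
    qed
    ultimately have "K2 \<subseteq> K1"
      using connected_Int_frontier[of "- K1" K2] assms(4) by blast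
    then show ?thesis
      using room[OF \<open>K2 \<subseteq> K1\<close> cl(2,1)] sep by (fastforce simp: dist_commute)
  qed
qed

subsection \<open>Words in quadratic polynomials\<close>

text \<open>The last letter acts first; prefixing a letter composes on the outside.\<close>

definition word :: "complex poly list \<Rightarrow> complex poly" where
  "word ws = foldr (\<circ>\<^sub>p) ws [:0, 1:]"

lemma word_Nil [simp]: "word [] = [:0, 1:]"
  and word_Cons [simp]: "word (h # ws) = h \<circ>\<^sub>p word ws"
  by (simp_all add: word_def)

lemma word_append: "word (us @ ws) = word us \<circ>\<^sub>p word ws"
  by (induction us) (simp_all add: pcompose_assoc pcompose_pCons)

lemma iterp_word: "iterp h n (word ws) = word (replicate n h @ ws)"
  by (induction n) (simp_all add: iterp_Suc)

section \<open>Quadratic polynomials as two-to-one maps\<close>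

definition crit :: "complex poly \<Rightarrow> complex" where
  "crit h = - coeff h 1 / (2 * coeff h 2)"

lemma quadratic_coeffs:
  assumes "degree h = 2"
  shows "coeff h 2 \<noteq> 0" "poly h z = coeff h 2 * (z - crit h)\<^sup>2 + poly h (crit h)"
proof -
  have h: "poly h z = coeff h 0 + z * (coeff h 1 + coeff h 2 * z)" for z
    using assms by (simp add: poly_altdef numeral_2_eq_2 algebra_simps power2_eq_square)
  show a: "coeff h 2 \<noteq> 0"
    using assms leading_coeff_neq_0[of h] by force
  have b: "coeff h 1 = - (2 * coeff h 2 * crit h)"
    using a by (simp add: crit_def)
  show "poly h z = coeff h 2 * (z - crit h)\<^sup>2 + poly h (crit h)"
    unfolding h b by (simp add: algebra_simps power2_eq_square)
qed

lemma quadratic_fibre: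
  assumes "degree h = 2"
  shows "poly h z = poly h w \<longleftrightarrow> w = z \<or> w = 2 * crit h - z"
proof -
  have "poly h z = poly h w \<longleftrightarrow> (z - crit h)\<^sup>2 = (w - crit h)\<^sup>2"
    using quadratic_coeffs[OF assms] by (metis add_right_cancel mult_left_cancel)
  also have "\<dots> \<longleftrightarrow> w = z \<or> w = 2 * crit h - z"
    by (auto simp: power2_eq_iff algebra_simps)
  finally show ?thesis .
qed

lemma poly_surj:
  fixes h :: "complex poly"
  assumes "degree h > 0"
  obtains z where "poly h z = w"
proof -
  have "degree (h + [:- w:]) = degree h"
    using assms by (intro degree_add_eq_left) simp
  then have "\<not> constant (poly (h + [:- w:]))"
    using assms constant_degree[of "h + [:- w:]"] by simp
  then obtain z where "poly (h + [:- w:]) z = 0"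
    using fundamental_theorem_of_algebra by blast
  then show ?thesis
    using that[of z] by simp
qed

lemma poly_sublevel_vimage: "poly h -` {z. cmod (poly p z) \<le> r} = {z. cmod (poly (p \<circ>\<^sub>p h) z) \<le> r}"
  by (simp add: poly_pcompose vimage_def)

text \<open>The deck involution \<open>z \<mapsto> 2 * crit h - z\<close> fixes the critical point, so the part of the
  preimage containing the critical point can be made invariant under it.\<close>

lemma connected_quadratic_vimage:
  assumes h: "degree h = 2" and "connected S" and T: "compact (poly h -` S)"
    and c: "poly h (crit h) \<in> S"
  shows "connected (poly h -` S)"
proof -
  define \<sigma> where "\<sigma> = (\<lambda>z. 2 * crit h - z)"
  let ?T = "poly h -` S"
  have sym: "\<sigma> z \<in> ?T \<longleftrightarrow> z \<in> ?T" for z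
    using quadratic_fibre[OF h, of z "\<sigma> z"] by (simp add: \<sigma>_def)
  have invol: "\<sigma> (\<sigma> z) = z" "\<sigma> (crit h) = crit h" for z
    by (simp_all add: \<sigma>_def)
  have no_sep: False if AB: "closed A" "closed B" "?T \<subseteq> A \<union> B" "A \<inter> B \<inter> ?T = {}" "B \<inter> ?T \<noteq> {}"
    and "crit h \<in> A" for A B
  proof -
    \<comment> \<open>Points of \<open>A\<close> whose conjugate lies in \<open>B\<close> are moved
      to \<open>B1\<close>. Both parts are then invariant under \<open>\<sigma>\<close>, so their
      images under \<open>h\<close> are disjoint; compactness makes the images closed, and they
      separate \<open>S\<close>.\<close>
    define A1 where "A1 = ?T \<inter> (A \<inter> \<sigma> -` A)"
    define B1 where "B1 = ?T \<inter> (B \<union> \<sigma> -` B)"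
    have clos: "closed (\<sigma> -` C)" if "closed C" for C
      using that unfolding \<sigma>_def by (intro closed_vimage continuous_intros)
    have "compact A1" "compact B1"
      using AB clos T by (auto simp: A1_def B1_def intro!: compact_Int_closed closed_Int closed_Un)
    then have "closed (poly h ` A1)" "closed (poly h ` B1)"
      by (auto intro!: compact_imp_closed compact_continuous_image continuous_intros)
    moreover have "S \<subseteq> poly h ` A1 \<union> poly h ` B1"
    proof
      fix w assume "w \<in> S"
      obtain z where "poly h z = w"
        using poly_surj[of h w] h by auto
      moreover have "z \<in> A1 \<union> B1"
        using \<open>w \<in> S\<close> \<open>poly h z = w\<close> AB(3) sym[of z] by (auto simp: A1_def B1_def)
      ultimately show "w \<in> poly h ` A1 \<union> poly h ` B1"
        by blast
    qed
    moreover have "poly h ` A1 \<inter> poly h ` B1 = {}"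
    proof -
      have "poly h a \<noteq> poly h b" if "a \<in> A1" "b \<in> B1" for a b
      proof
        assume "poly h a = poly h b"
        then have "b = a \<or> b = \<sigma> a"
          using quadratic_fibre[OF h, of a b] by (simp add: \<sigma>_def)
        then have "b \<in> A" "\<sigma> b \<in> A"
          using that(1) by (auto simp: A1_def invol)
        then show False
          using that(2) AB(4) sym[of b] by (auto simp: B1_def)
      qed
      then show ?thesis
        by blast
    qed
    moreover have "poly h ` A1 \<inter> S \<noteq> {}"
    proof -
      have "crit h \<in> A1"
        using c \<open>crit h \<in> A\<close> by (simp add: A1_def invol)
      then have "poly h (crit h) \<in> poly h ` A1"
        by (rule imageI)
      then show ?thesis
        using c by (metis IntI empty_iff)
    qed
    moreover have "poly h ` B1 \<inter> S \<noteq> {}"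
      using AB(5) by (auto simp: B1_def)
    ultimately show False
      using connected_closedD[OF \<open>connected S\<close>, of "poly h ` A1" "poly h ` B1"] by simp
  qed
  show ?thesis
    unfolding connected_closed
  proof (intro notI, elim exE conjE)
    fix A B
    assume AB: "closed A" "closed B" "?T \<subseteq> A \<union> B" "A \<inter> B \<inter> ?T = {}" "A \<inter> ?T \<noteq> {}" "B \<inter> ?T \<noteq> {}"
    consider "crit h \<in> A" | "crit h \<in> B"
      using c AB(3) by blast
    then show False
    proof cases
      case 1
      then show ?thesis
        using no_sep[OF AB(1,2,3,4,6)] by simp
    next
      case 2
      then show ?thesis
        using no_sep[OF AB(2,1) _ _ AB(5)] AB(3,4) by (simp add: Int_commute[of B A] Un_commute[of B A])
    qed
  qed
qed

section \<open>Consequences of a uniform bound on critical orbits\<close>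

locale postcritically_bounded_quadratics =
  fixes \<Gamma> :: "complex poly set" and R :: real
  assumes degree_2: "h \<in> \<Gamma> \<Longrightarrow> degree h = 2"
    and critical_orbit: "h \<in> \<Gamma> \<Longrightarrow> ws \<in> lists \<Gamma> \<Longrightarrow> cmod (poly (word ws) (poly h (crit h))) \<le> R"
begin

lemma degree_word: "ws \<in> lists \<Gamma> \<Longrightarrow> degree (word ws) = 2 ^ length ws"
  by (induction ws) (auto simp: degree_pcompose degree_2)

lemma degree_word_pos: "ws \<in> lists \<Gamma> \<Longrightarrow> degree (word ws) > 0"
  by (simp add: degree_word)

lemma replicate_in_lists: "h \<in> \<Gamma> \<Longrightarrow> ws \<in> lists \<Gamma> \<Longrightarrow> replicate n h @ ws \<in> lists \<Gamma>"
  by (auto simp: in_lists_conv_set)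

text \<open>Induction on the letter acting first: the new set is the preimage under \<open>h\<close>
  of the old one, which contains the critical value of \<open>h\<close> because
  \<open>R \<le> r\<close>.\<close>

lemma connected_word_sublevel:
  assumes "ws \<in> lists \<Gamma>" "R \<le> r"
  shows "connected {z. cmod (poly (word ws) z) \<le> r}"
  using assms(1)
proof (induction ws rule: rev_induct)
  case Nil
  have "{z. cmod z \<le> r} = cball 0 r"
    by auto
  then show ?case
    by simp
next
  case (snoc h ws)
  then have h: "h \<in> \<Gamma>" "ws \<in> lists \<Gamma>"
    by auto
  have eq: "{z. cmod (poly (word (ws @ [h])) z) \<le> r} = poly h -` {z. cmod (poly (word ws) z) \<le> r}"
    by (simp only: poly_sublevel_vimage word_append word_Cons word_Nil pcompose_idR)
  show ?case
    unfolding eq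
  proof (rule connected_quadratic_vimage)
    show "compact (poly h -` {z. cmod (poly (word ws) z) \<le> r})"
      unfolding eq[symmetric] using snoc.prems by (intro compact_poly_sublevel degree_word_pos)
  qed (use h snoc critical_orbit[OF h] assms(2) degree_2 in auto)
qed

lemma escape_radius_ge:
  assumes "h \<in> \<Gamma>"
  obtains r where "escape_radius h r" "s \<le> r"
  using assms by (meson degree_2 escape_radius_exists escape_radius_mono max.cobounded1 max.cobounded2)

text \<open>Iterating \<open>h\<close> after \<open>ws\<close> gives words again, so the orbit is
  bounded by \<open>R\<close>. In particular any two of the filled sets intersect.\<close>

lemma critical_value_in_filled:
  assumes "h \<in> \<Gamma>" "g \<in> \<Gamma>" "ws \<in> lists \<Gamma>"
  shows "poly g (crit g) \<in> filled h (word ws)"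
  unfolding filled_def iterp_word
  using critical_orbit[OF assms(2) replicate_in_lists[OF assms(1,3)]] by (auto simp: bounded_iff)

lemma compact_filled_word:
  "h \<in> \<Gamma> \<Longrightarrow> ws \<in> lists \<Gamma> \<Longrightarrow> compact (filled h (word ws))"
  by (intro compact_filled degree_2 degree_word_pos)

text \<open>A decreasing intersection of connected compact sublevel sets, those of the words
  \<open>replicate n h @ ws\<close>.\<close>

lemma connected_filled_word:
  assumes "h \<in> \<Gamma>" "ws \<in> lists \<Gamma>"
  shows "connected (filled h (word ws))"
proof -
  obtain r where r: "escape_radius h r" "R \<le> r"
    using escape_radius_ge assms by blast
  show ?thesis
    unfolding filled_eq_Inter[OF r(1)]
  proof (rule connected_nest)
    fix n
    have "replicate n h @ ws \<in> lists \<Gamma>"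
      by (intro replicate_in_lists assms)
    then show "compact {z. cmod (poly (iterp h n (word ws)) z) \<le> r}"
        and "connected {z. cmod (poly (iterp h n (word ws)) z) \<le> r}"
      unfolding iterp_word
      by (intro compact_poly_sublevel degree_word_pos connected_word_sublevel r(2); assumption)+
  qed (rule filled_sublevel_decseq[OF r(1)])
qed

lemma connected_frontier_filled:
  assumes "h \<in> \<Gamma>" "ws \<in> lists \<Gamma>"
  shows "connected (frontier (filled h (word ws)))"
  using assms by (intro connected_frontier_simple connected_filled_word connected_Compl_filled
      degree_2 degree_word_pos)

lemma frontier_filled_nonempty:
  assumes "h \<in> \<Gamma>" "ws \<in> lists \<Gamma>"
  shows "frontier (filled h (word ws)) \<noteq> {}"
proof -
  have "filled h (word ws) \<noteq> UNIV"
    using compact_imp_bounded[OF compact_filled_word[OF assms]] not_bounded_UNIV by metis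
  then show ?thesis
    using critical_value_in_filled[OF assms(1,1,2)] by (auto simp: frontier_eq_empty)
qed

text \<open>The filled sets share a critical value, so separated frontiers force one into the other
  with margin \<open>\<delta>\<close>; \<open>capacity_mono_strict\<close> turns the margin into a
  factor whose exponent is the degree of the words.\<close>

lemma capacity_gap:
  assumes h: "h1 \<in> \<Gamma>" "h2 \<in> \<Gamma>" and u: "u1 \<in> lists \<Gamma>" "u2 \<in> lists \<Gamma>" "length u1 = length u2"
    and \<delta>: "\<delta> > 0" and M: "M > 0"
    and sub: "filled h1 (word u1) \<subseteq> cball p M" "filled h2 (word u2) \<subseteq> cball p M"
    and sep: "\<And>x y. x \<in> frontier (filled h1 (word u1)) \<Longrightarrow> y \<in> frontier (filled h2 (word u2))
      \<Longrightarrow> \<delta> \<le> dist x y"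
  defines "x1 \<equiv> cmod (lead_coeff h1 * lead_coeff (word u1))"
    and "x2 \<equiv> cmod (lead_coeff h2 * lead_coeff (word u2))"
  shows "x2 * (1 + \<delta> / (2 * M)) ^ 2 ^ length u1 \<le> x1 \<or> x1 * (1 + \<delta> / (2 * M)) ^ 2 ^ length u1 \<le> x2"
proof -
  have deg: "degree (word u1) = 2 ^ length u1" "degree (word u2) = 2 ^ length u1"
    using u by (simp_all add: degree_word)
  have "(\<forall>z\<in>filled h1 (word u1). ball z \<delta> \<subseteq> filled h2 (word u2)) \<or>
        (\<forall>z\<in>filled h2 (word u2). ball z \<delta> \<subseteq> filled h1 (word u1))"
  proof (rule nested_of_separated_frontiers)
    show "filled h1 (word u1) \<inter> filled h2 (word u2) \<noteq> {}"
      using critical_value_in_filled h u by blast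
  qed (use h u \<delta> sep in \<open>auto intro!: compact_filled_word connected_filled_word
        connected_frontier_filled connected_Compl_filled degree_2 degree_word_pos\<close>)
  then show ?thesis
  proof
    assume "\<forall>z\<in>filled h1 (word u1). ball z \<delta> \<subseteq> filled h2 (word u2)"
    then have "x2 * (1 + \<delta> / (2 * M)) ^ degree (word u1) \<le> x1"
      unfolding x1_def x2_def using h deg M sub \<delta> degree_2
      by (intro capacity_mono_strict[of _ _ _ _ _ _ p]) (auto simp: subset_iff)
    then show ?thesis
      by (simp add: deg)
  next
    assume "\<forall>z\<in>filled h2 (word u2). ball z \<delta> \<subseteq> filled h1 (word u1)"
    then have "x1 * (1 + \<delta> / (2 * M)) ^ degree (word u2) \<le> x2"
      unfolding x1_def x2_def using h deg M sub \<delta> degree_2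
      by (intro capacity_mono_strict[of _ _ _ _ _ _ p]) (auto simp: subset_iff)
    then show ?thesis
      by (simp add: deg)
  qed
qed

text \<open>For two quadratic polynomials these two sets have the same capacity, so that neither can lie
  in the interior of the other. For higher degrees this fails.\<close>

lemma frontiers_meet:
  assumes h: "h1 \<in> \<Gamma>" "h2 \<in> \<Gamma>" and u: "u \<in> lists \<Gamma>"
  shows "frontier (filled h2 (word (h1 # u))) \<inter> frontier (filled h1 (word (h2 # u))) \<noteq> {}"
proof
  let ?K1 = "filled h2 (word (h1 # u))" and ?K2 = "filled h1 (word (h2 # u))"
  assume disj: "frontier ?K1 \<inter> frontier ?K2 = {}"
  have comp: "compact ?K1" "compact ?K2"
    using h u by (intro compact_filled_word; simp)+
  obtain \<delta> where \<delta>: "\<delta> > 0" "\<forall>x\<in>frontier ?K1. \<forall>y\<in>frontier ?K2. \<delta> \<le> dist x y"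
    using separate_compact_closed[OF compact_frontier[OF comp(1)] frontier_closed disj] by blast
  obtain M where M: "M > 0" "?K1 \<union> ?K2 \<subseteq> cball 0 M"
    using compact_imp_bounded[OF compact_Un[OF comp]] unfolding bounded_pos by fastforce
  define x where "x = cmod (lead_coeff h1 * lead_coeff h2 * lead_coeff (word u) ^ 2)"
  have nz: "h1 \<noteq> 0" "h2 \<noteq> 0" "word u \<noteq> 0"
    using degree_2 h degree_word_pos[OF u] by force+
  then have "x > 0"
    by (simp add: x_def)
  have lead: "lead_coeff (word (h # u)) = lead_coeff h * lead_coeff (word u) ^ 2" if "h \<in> \<Gamma>" for h
    using lead_coeff_comp[OF degree_word_pos[OF u], of h] degree_2[OF that] by simp
  \<comment> \<open>With leading coefficients \<open>a1\<close>, \<open>a2\<close> of the letters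
    and \<open>l\<close> of \<open>word u\<close>, either order gives \<open>a1 * a2 * l^2\<close>.
    Both alternatives of \<open>capacity_gap\<close> then become the same impossible
    inequality.\<close>
  have eq: "cmod (lead_coeff h2 * lead_coeff (word (h1 # u))) = x"
    "cmod (lead_coeff h1 * lead_coeff (word (h2 # u))) = x"
    unfolding lead[OF h(1)] lead[OF h(2)] x_def by (simp_all add: norm_mult)
  have "x * (1 + \<delta> / (2 * M)) ^ 2 ^ length (h1 # u) \<le> x"
    using capacity_gap[OF h(2,1) _ _ _ \<delta>(1) M(1), of "h1 # u" "h2 # u" 0] h u \<delta>(2) M(2)
    unfolding eq by auto
  moreover have "1 < (1 + \<delta> / (2 * M)) ^ 2 ^ length (h1 # u)"
    using \<delta> M by (intro one_less_power) auto
  ultimately show False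
    using \<open>x > 0\<close> by (simp add: mult_le_cancel_left1)
qed

text \<open>The letters of \<open>v\<close> preserve the exterior of the common escape disc. The
  bounding set does not depend on \<open>v\<close>.\<close>

lemma filled_append_subset:
  assumes r: "escape_radius h1 r" "escape_radius h2 r" and h: "h = h1 \<or> h = h2"
    and v: "v \<in> lists {h1, h2}"
  shows "filled h (word (v @ ws)) \<subseteq> {z. cmod (poly (word ws) z) \<le> r}"
proof
  fix z assume "z \<in> filled h (word (v @ ws))"
  then have "cmod (poly (iterp h 0 (word (v @ ws))) z) \<le> r"
    using filled_eq r h by blast
  moreover have "r < cmod (poly (word (v @ ws)) z)" if "r < cmod (poly (word ws) z)"
    using v
  proof (induction v)
    case (Cons g v)
    then show ?case
      using r by (fastforce simp: escape_radius_def poly_pcompose)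
  qed (use that in simp)
  ultimately show "z \<in> {z. cmod (poly (word ws) z) \<le> r}"
    by (force simp: not_le[symmetric])
qed

section \<open>Propagating a separation along words\<close>

context
  fixes A B :: "complex set"
  assumes closed_AB: "closed A" "closed B" and disjoint_AB: "A \<inter> B = {}"
    and cover: "\<And>h ws. h \<in> \<Gamma> \<Longrightarrow> ws \<in> lists \<Gamma> \<Longrightarrow> frontier (filled h (word ws)) \<subseteq> A \<union> B"
begin

lemma frontier_side:
  assumes "h \<in> \<Gamma>" "ws \<in> lists \<Gamma>"
  shows "frontier (filled h (word ws)) \<subseteq> A \<or> frontier (filled h (word ws)) \<subseteq> B"
  using connected_closedD[OF connected_frontier_filled[OF assms] _ cover[OF assms] closed_AB]
    disjoint_AB cover[OF assms] by blast

text \<open>The words \<open>v\<close> are found by bisection: as \<open>h1 h2 h2 \<dots>\<close> and \<open>h2 h1 h1 \<dots>\<close> give sets on the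
  same side, one of the letters \<open>h1\<close>, \<open>h2\<close> can be prefixed.\<close>

lemma separated_words:
  assumes h: "h1 \<in> \<Gamma>" "h2 \<in> \<Gamma>" and ws: "ws \<in> lists \<Gamma>"
    and side: "frontier (filled h1 (word ws)) \<subseteq> A" "frontier (filled h2 (word ws)) \<subseteq> B"
  shows "\<exists>v\<in>lists {h1, h2}. length v = n \<and> frontier (filled h1 (word (v @ ws))) \<subseteq> A
    \<and> frontier (filled h2 (word (v @ ws))) \<subseteq> B"
proof (induction n)
  case 0
  then show ?case
    using side by auto
next
  case (Suc n)
  then obtain v where v: "v \<in> lists {h1, h2}" "length v = n"
    "frontier (filled h1 (word (v @ ws))) \<subseteq> A" "frontier (filled h2 (word (v @ ws))) \<subseteq> B"
    by blast
  have vws: "v @ ws \<in> lists \<Gamma>"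
    using v(1) ws h by (auto simp: in_lists_conv_set)
  have meet: "frontier (filled h2 (word (h1 # v @ ws))) \<inter> frontier (filled h1 (word (h2 # v @ ws))) \<noteq> {}"
    by (rule frontiers_meet[OF h vws])
  show ?case
  \<comment> \<open>Prefixing a letter leaves the set of that same letter unchanged, so only the
    other letter's set has to be checked.\<close>
  proof (cases "frontier (filled h2 (word (h1 # v @ ws))) \<subseteq> B")
    case True
    then show ?thesis
      using v by (intro bexI[of _ "h1 # v"]) (auto simp: filled_pcompose_self)
  next
    case False
    then have "frontier (filled h2 (word (h1 # v @ ws))) \<subseteq> A"
      using frontier_side[of h2 "h1 # v @ ws"] h vws by auto
    then have "frontier (filled h1 (word (h2 # v @ ws))) \<subseteq> A"
      using frontier_side[of h1 "h2 # v @ ws"] h vws meet disjoint_AB by auto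
    then show ?thesis
      using v by (intro bexI[of _ "h2 # v"]) (auto simp: filled_pcompose_self)
  qed
qed

lemma same_side:
  assumes h: "h1 \<in> \<Gamma>" "h2 \<in> \<Gamma>" and ws: "ws \<in> lists \<Gamma>"
    and side: "frontier (filled h1 (word ws)) \<subseteq> A"
  shows "frontier (filled h2 (word ws)) \<subseteq> A"
proof (rule ccontr)
  assume "\<not> ?thesis"
  then have side2: "frontier (filled h2 (word ws)) \<subseteq> B"
    using frontier_side[OF h(2) ws] by blast
  obtain r1 r2 where "escape_radius h1 r1" "escape_radius h2 r2"
    using escape_radius_exists degree_2 h by metis
  then obtain r where r: "escape_radius h1 r" "escape_radius h2 r"
    by (meson escape_radius_mono max.cobounded1 max.cobounded2)
  \<comment> \<open>All filled sets obtained by prefixing words \<open>v\<close> lie in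
    \<open>C\<close>, so \<open>\<delta>\<close> and \<open>M\<close> can be fixed before the length
    of \<open>v\<close>.\<close>
  define C where "C = {z. cmod (poly (word ws) z) \<le> r}"
  have C: "compact C"
    unfolding C_def using ws by (intro compact_poly_sublevel degree_word_pos)
  obtain \<delta> where \<delta>: "\<delta> > 0" "\<forall>x\<in>A \<inter> C. \<forall>y\<in>B. \<delta> \<le> dist x y"
  proof -
    have "compact (A \<inter> C)" "A \<inter> C \<inter> B = {}"
      using C closed_AB disjoint_AB by (auto intro: closed_Int_compact)
    then show ?thesis
      using separate_compact_closed[OF _ closed_AB(2)] that by blast
  qed
  obtain M where M: "M > 0" "C \<subseteq> cball 0 M"
    using compact_imp_bounded[OF C] unfolding bounded_pos by fastforce
  define a1 a2 where "a1 = cmod (lead_coeff h1)" and "a2 = cmod (lead_coeff h2)"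
  have "h1 \<noteq> 0" "h2 \<noteq> 0"
    using degree_2 h by force+
  then have a: "a1 > 0" "a2 > 0"
    by (simp_all add: a1_def a2_def)
  \<comment> \<open>Both filled sets come from the same word, so its leading coefficient cancels and
    the right-hand side does not depend on \<open>n\<close>.\<close>
  have bound: "(1 + \<delta> / (2 * M)) ^ 2 ^ (n + length ws) \<le> a1 / a2 + a2 / a1" for n
  proof -
    obtain v where v: "v \<in> lists {h1, h2}" "length v = n"
      "frontier (filled h1 (word (v @ ws))) \<subseteq> A" "frontier (filled h2 (word (v @ ws))) \<subseteq> B"
      using separated_words[OF h ws side side2] by blast
    let ?u = "v @ ws" and ?q = "(1 + \<delta> / (2 * M)) ^ 2 ^ (n + length ws)"
    have u: "?u \<in> lists \<Gamma>"
      using v(1) ws h by (auto simp: in_lists_conv_set)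
    have sub: "filled h1 (word ?u) \<subseteq> C" "filled h2 (word ?u) \<subseteq> C"
      unfolding C_def using v(1) r by (intro filled_append_subset[of h1 r h2]; simp)+
    have "frontier (filled h1 (word ?u)) \<subseteq> C"
      using frontier_subset_compact[OF compact_filled_word[OF h(1) u]] sub by blast
    then have sep: "\<delta> \<le> dist x y"
      if "x \<in> frontier (filled h1 (word ?u))" "y \<in> frontier (filled h2 (word ?u))" for x y
      using that v(3,4) \<delta>(2) by blast
    define l where "l = cmod (lead_coeff (word ?u))"
    have "word ?u \<noteq> 0"
      using degree_word_pos[OF u] by force
    then have "l > 0"
      by (simp add: l_def)
    have "a2 * l * ?q \<le> a1 * l \<or> a1 * l * ?q \<le> a2 * l"
      using capacity_gap[OF h u u refl \<delta>(1) M(1) order_trans[OF sub(1) M(2)]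
          order_trans[OF sub(2) M(2)] sep] v(2)
      by (simp add: a1_def a2_def l_def norm_mult)
    then have "?q \<le> a1 / a2 \<or> ?q \<le> a2 / a1"
      using \<open>l > 0\<close> a by (auto simp: field_simps)
    moreover have "a1 / a2 > 0" "a2 / a1 > 0"
      using a by simp_all
    ultimately show ?thesis
      by linarith
  qed
  have "1 + \<delta> / (2 * M) > 1"
    using \<delta> M by simp
  then obtain n where "n \<ge> length ws" "a1 / a2 + a2 / a1 < (1 + \<delta> / (2 * M)) ^ 2 ^ n"
    by (rule power_power2_unbounded)
  then show False
    using bound[of "n - length ws"] by simp
qed

lemma all_same_side:
  assumes "h0 \<in> \<Gamma>" "frontier (filled h0 (word [])) \<subseteq> A"
  shows "h \<in> \<Gamma> \<Longrightarrow> ws \<in> lists \<Gamma> \<Longrightarrow> frontier (filled h (word ws)) \<subseteq> A"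
proof (induction ws arbitrary: h)
  case Nil
  then show ?case
    using same_side[OF assms(1) Nil(1) _ assms(2)] by simp
next
  case (Cons g ws)
  then have "frontier (filled g (word (g # ws))) \<subseteq> A"
    by (auto simp: filled_pcompose_self)
  then show ?case
    using same_side[of g h "g # ws"] Cons.prems by auto
qed

end

end

subsection \<open>Montel's theorem on the sphere\<close>

lemma openin_local_param_ball:
  assumes "d > 0"
  shows "openin riemann_sphere (local_param x ` ball 0 d)"
proof (cases x)
  case (Some a)
  have "local_param x ` ball 0 d = Some ` ((+) a ` ball 0 d)"
    unfolding image_image local_param_def Some by simp
  then show ?thesis
    by (simp add: open_translation)
next
  case None
  have "local_param x ` ball 0 d = insert None (Some ` (topspace euclidean - cball (0::complex) (1 / d)))"
  proof (intro equalityI subsetI)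
    fix y assume "y \<in> insert None (Some ` (topspace euclidean - cball (0::complex) (1 / d)))"
    then consider "y = None" | z where "y = Some z" "1 / d < cmod z"
      by auto
    then show "y \<in> local_param x ` ball 0 d"
    proof cases
      case 1
      then show ?thesis
        using assms by (intro image_eqI[of _ _ 0]) (auto simp: local_param_def None)
    next
      case 2
      then have "z \<noteq> 0"
        using assms by auto
      then show ?thesis
        using 2 assms by (intro image_eqI[of _ _ "inverse z"])
          (auto simp: local_param_def None norm_inverse norm_divide field_simps)
    qed
  next
    fix y assume "y \<in> local_param x ` ball 0 d"
    then obtain w where w: "cmod w < d" "y = local_param x w"
      by auto
    have "1 / d < cmod (inverse w)" if "w \<noteq> 0"
      using that w(1) assms by (simp add: norm_inverse norm_divide field_simps)
    then show "y \<in> insert None (Some ` (topspace euclidean - cball (0::complex) (1 / d)))"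
      using w(2) by (force simp: local_param_def None)
  qed
  then show ?thesis
    unfolding openin_Alexandroff_compactification by (metis closed_cball closed_closedin compact_cball compactin_euclidean_iff)
qed

lemma local_param_ball_subset:
  assumes "openin riemann_sphere V" "x \<in> V"
  obtains \<epsilon> where "\<epsilon> > 0" "local_param x ` ball 0 \<epsilon> \<subseteq> V"
proof (cases x)
  case (Some a)
  have "open {z. Some z \<in> V}"
    using openin_continuous_map_preimage[OF continuous_map_Some assms(1)] by simp
  then obtain \<epsilon> where "\<epsilon> > 0" "ball a \<epsilon> \<subseteq> {z. Some z \<in> V}"
    using assms(2) Some openE by blast
  then show ?thesis
    by (intro that[of \<epsilon>]) (auto simp: local_param_def Some subset_iff dist_norm)
next
  case None
  obtain C where C: "compact C" "V = insert None (Some ` (- C))"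
    using assms None unfolding openin_Alexandroff_compactification by (auto simp: Compl_eq_Diff_UNIV)
  obtain M where M: "M > 0" "\<forall>z\<in>C. cmod z \<le> M"
    using compact_imp_bounded[OF C(1)] unfolding bounded_pos by blast
  have "inverse w \<notin> C" if "cmod w < 1 / M" "w \<noteq> 0" for w
  proof -
    have "M < cmod (inverse w)"
      using that M by (simp add: norm_inverse norm_divide field_simps)
    then show ?thesis
      using M by force
  qed
  then show ?thesis
    using M C by (intro that[of "1 / M"]) (auto simp: local_param_def None)
qed

lemma local_coord_local_param: "local_coord x (local_param x w) = w"
  by (simp add: local_coord_def local_param_def split: option.splits)

text \<open>The Moebius transformation taking \<open>p\<close>, \<open>q\<close>, \<open>s\<close> to \<open>0\<close>, infinity, \<open>1\<close>; its value at \<open>q\<close>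
  is a dummy.\<close>

definition three_point_map :: "complex \<Rightarrow> complex \<Rightarrow> complex \<Rightarrow> sphere \<Rightarrow> complex" where
  "three_point_map p q s x = (case x of
      None \<Rightarrow> (s - q) / (s - p)
    | Some z \<Rightarrow> ((z - p) * (s - q)) / ((z - q) * (s - p)))"

text \<open>The denominator \<open>v\<close> vanishes at the value that
  \<open>three_point_map\<close> takes at infinity.\<close>

definition three_point_inv :: "complex \<Rightarrow> complex \<Rightarrow> complex \<Rightarrow> complex \<Rightarrow> sphere" where
  "three_point_inv p q s \<zeta> = (let v = \<zeta> * (s - p) - (s - q) in
     if v = 0 then None else Some ((\<zeta> * q * (s - p) - p * (s - q)) / v))"

lemma three_point_inv_map:
  assumes "distinct [p, q, s]" "x \<noteq> Some q"
  shows "three_point_inv p q s (three_point_map p q s x) = x"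
proof (cases x)
  case (Some z)
  define m where "m = three_point_map p q s x"
  have z: "z \<noteq> q"
    using assms Some by auto
  have m: "m * (z - q) * (s - p) = (z - p) * (s - q)"
    using assms(1) z by (auto simp: m_def three_point_map_def Some)
  have v: "(m * (s - p) - (s - q)) * (z - q) = (q - p) * (s - q)"
    using m by algebra
  have v0: "m * (s - p) - (s - q) \<noteq> 0"
    using v assms by auto
  have "z * (m * (s - p) - (s - q)) = m * q * (s - p) - p * (s - q)"
    using m by algebra
  then have "(m * q * (s - p) - p * (s - q)) / (m * (s - p) - (s - q)) = z"
    using v0 by (simp add: divide_eq_eq)
  then show ?thesis
    using v0 unfolding m_def[symmetric] unfolding three_point_inv_def Let_def Some by simp
qed (use assms in \<open>auto simp: three_point_map_def three_point_inv_def\<close>)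

text \<open>The value \<open>0\<close> belongs to \<open>p\<close> and the value \<open>1\<close> to
  \<open>s\<close>; at \<open>q\<close> the dummy value is \<open>0\<close>.\<close>

lemma three_point_map_omits:
  assumes "distinct [p, q, s]" "x \<notin> {Some p, Some q, Some s}"
  shows "three_point_map p q s x \<noteq> 0 \<and> three_point_map p q s x \<noteq> 1"
proof (cases x)
  case (Some z)
  have "z = s" if "(z - p) * (s - q) = (z - q) * (s - p)"
  proof -
    have "(z - s) * (p - q) = 0"
      using that by algebra
    then show ?thesis
      using assms by auto
  qed
  then show ?thesis
    using assms Some by (auto simp: three_point_map_def divide_eq_eq)
qed (use assms in \<open>auto simp: three_point_map_def\<close>)

text \<open>Exchanges zero and pole; the dummy values agree because
  \<open>inverse 0 = 0\<close>.\<close>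

lemma three_point_map_swap: "three_point_map q p s x = inverse (three_point_map p q s x)"
  by (auto simp: three_point_map_def split: option.splits)

text \<open>In homogeneous coordinates \<open>u : v\<close> the stereographic formula has no singularity.\<close>

lemma continuous_stereo_three_point_inv:
  assumes "distinct [p, q, s]"
  shows "continuous_on UNIV (\<lambda>\<zeta>. stereo (three_point_inv p q s \<zeta>))"
proof -
  define u where "u = (\<lambda>\<zeta>. \<zeta> * q * (s - p) - p * (s - q))"
  define v where "v = (\<lambda>\<zeta>. \<zeta> * (s - p) - (s - q))"
  define N where "N = (\<lambda>\<zeta>. (cmod (u \<zeta>))\<^sup>2 + (cmod (v \<zeta>))\<^sup>2)"
  have uv: "v \<zeta> = 0 \<Longrightarrow> u \<zeta> \<noteq> 0" for \<zeta>
  proof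
    assume "v \<zeta> = 0" "u \<zeta> = 0"
    then have "(q - p) * (s - q) = 0"
      unfolding u_def v_def by algebra
    then show False
      using assms by auto
  qed
  have N: "N \<zeta> \<noteq> 0" for \<zeta>
    using uv[of \<zeta>] by (auto simp: N_def sum_power2_eq_zero_iff)
  have "stereo (three_point_inv p q s \<zeta>) =
      (of_real (2 / N \<zeta>) * (u \<zeta> * cnj (v \<zeta>)), ((cmod (u \<zeta>))\<^sup>2 - (cmod (v \<zeta>))\<^sup>2) / N \<zeta>)" for \<zeta>
  proof (cases "v \<zeta> = 0")
    case True
    then have "three_point_inv p q s \<zeta> = None"
      by (simp add: three_point_inv_def v_def)
    then show ?thesis
      using uv[OF True] True by (simp add: stereo_def N_def)
  next
    case False
    define z where "z = u \<zeta> / v \<zeta>"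
    have z: "u \<zeta> = z * v \<zeta>"
      using False by (simp add: z_def)
    have inv: "three_point_inv p q s \<zeta> = Some z"
      using False by (simp add: three_point_inv_def z_def u_def v_def Let_def)
    have Nz: "N \<zeta> = ((cmod z)\<^sup>2 + 1) * (cmod (v \<zeta>))\<^sup>2"
      by (simp add: N_def z norm_mult power_mult_distrib algebra_simps)
    have "u \<zeta> * cnj (v \<zeta>) = z * of_real ((cmod (v \<zeta>))\<^sup>2)"
      unfolding complex_norm_square by (simp add: z)
    moreover have "(cmod (u \<zeta>))\<^sup>2 - (cmod (v \<zeta>))\<^sup>2 = ((cmod z)\<^sup>2 - 1) * (cmod (v \<zeta>))\<^sup>2"
      by (simp add: z norm_mult power_mult_distrib algebra_simps)
    moreover have "(cmod (v \<zeta>))\<^sup>2 \<noteq> 0"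
      using False by simp
    ultimately show ?thesis
      by (simp add: inv stereo_def Nz del: power_eq_0_iff of_real_power)
  qed
  moreover have "continuous_on UNIV (\<lambda>\<zeta>. (complex_of_real (2 / N \<zeta>) * (u \<zeta> * cnj (v \<zeta>)),
      ((cmod (u \<zeta>))\<^sup>2 - (cmod (v \<zeta>))\<^sup>2) / N \<zeta>))"
    using N unfolding N_def u_def v_def by (intro continuous_intros) auto
  ultimately show ?thesis
    by simp
qed

text \<open>In the chart at infinity the quotient of \<open>P - p\<close> by \<open>P - q\<close>
  becomes a quotient of reflected polynomials of equal degree, which is regular at
  \<open>w = 0\<close> with the value assigned to \<open>None\<close>.\<close>

lemma holomorphic_three_point_map:
  assumes "distinct [p, q, s]" "degree P > 0"
    and omit: "\<And>w. w \<in> ball 0 \<epsilon> \<Longrightarrow> poly_map P (local_param x w) \<noteq> Some q"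
  shows "(\<lambda>w. three_point_map p q s (poly_map P (local_param x w))) holomorphic_on ball 0 \<epsilon>"
proof (cases x)
  case (Some a)
  have "poly P (a + w) \<noteq> q" if "w \<in> ball 0 \<epsilon>" for w
    using omit[OF that] by (simp add: local_param_def poly_map_def Some)
  then have "(\<lambda>w. ((poly P (a + w) - p) * (s - q)) / ((poly P (a + w) - q) * (s - p))) holomorphic_on ball 0 \<epsilon>"
    using assms(1) by (intro holomorphic_intros) auto
  then show ?thesis
    by (simp add: local_param_def poly_map_def three_point_map_def Some)
next
  case None
  define D where "D = degree P"
  have sub: "degree (P + [:- c:]) = D" "lead_coeff (P + [:- c:]) = lead_coeff P" for c
    using assms(2) by (simp_all add: D_def degree_add_eq_left coeff_eq_0)
  have refl: "poly (reflect_poly (P + [:- c:])) w = w ^ D * (poly P (inverse w) - c)" if "w \<noteq> 0" for c w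
    using that sub by (simp add: poly_reflect_poly_nz)
  have "poly (reflect_poly (P + [:- q:])) w \<noteq> 0" if "w \<in> ball 0 \<epsilon>" for w
  proof (cases "w = 0")
    case True
    have "P \<noteq> 0"
      using assms(2) by auto
    then show ?thesis
      using sub[of q] True by (simp add: D_def)
  next
    case False
    then show ?thesis
      using omit[OF that] refl[OF False] by (simp add: local_param_def poly_map_def None)
  qed
  then have "(\<lambda>w. (poly (reflect_poly (P + [:- p:])) w * (s - q)) / (poly (reflect_poly (P + [:- q:])) w * (s - p)))
      holomorphic_on ball 0 \<epsilon>" (is "?f holomorphic_on _")
    using assms(1) by (intro holomorphic_intros) auto
  moreover have "?f w = three_point_map p q s (poly_map P (local_param x w))" for w
  proof (cases "w = 0")
    case True
    have "P \<noteq> 0" "degree P \<noteq> 0"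
      using assms(2) by auto
    then show ?thesis
      using sub True by (simp add: local_param_def poly_map_def three_point_map_def None D_def)
  next
    case False
    then show ?thesis
      using refl[OF False] assms(2)
      by (simp add: local_param_def poly_map_def three_point_map_def None mult.assoc)
  qed
  ultimately show ?thesis
    by simp
qed

text \<open>\<open>GPicard1\<close> bounds uniformly near \<open>0\<close> all functions that omit
  \<open>0\<close> and \<open>1\<close> and have modulus at most \<open>1\<close> at the centre;
  Montel's theorem for bounded families then applies. \<open>d\<close> and \<open>B\<close> precede
  the choice of the sequence.\<close>

lemma montel_omitting_01:
  assumes "\<epsilon> > 0"
  obtains d B where "0 < d" "d \<le> \<epsilon>"
    "\<And>\<phi> :: nat \<Rightarrow> complex \<Rightarrow> complex. (\<And>n. \<phi> n holomorphic_on ball 0 \<epsilon>) \<Longrightarrow>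
       (\<And>n w. w \<in> ball 0 \<epsilon> \<Longrightarrow> \<phi> n w \<noteq> 0 \<and> \<phi> n w \<noteq> 1) \<Longrightarrow> (\<And>n. cmod (\<phi> n 0) \<le> 1) \<Longrightarrow>
       \<exists>r g. strict_mono r \<and> uniform_limit (ball 0 d) (\<lambda>n. \<phi> (r n)) g sequentially \<and>
         (\<forall>n. \<forall>w\<in>ball 0 d. \<phi> n w \<in> cball 0 B)"
proof -
  define X where "X = {\<phi> :: complex \<Rightarrow> complex. \<phi> holomorphic_on ball 0 \<epsilon> \<and>
    (\<forall>w\<in>ball 0 \<epsilon>. \<phi> w \<noteq> 0 \<and> \<phi> w \<noteq> 1) \<and> cmod (\<phi> 0) \<le> 1}"
  obtain B Z where Z: "open Z" "0 \<in> Z" "Z \<subseteq> ball 0 \<epsilon>"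
    and B: "\<And>h z. h \<in> X \<Longrightarrow> z \<in> Z \<Longrightarrow> cmod (h z) \<le> B"
    by (rule GPicard1[of "ball 0 \<epsilon>" 0 1 X X]) (use assms in \<open>auto simp: X_def\<close>)
  obtain e where e: "e > 0" "ball 0 e \<subseteq> Z"
    using Z openE by blast
  \<comment> \<open>Halving puts the closed disc inside \<open>ball 0 e\<close>, where convergence
    is uniform on compact sets.\<close>
  define d where "d = min \<epsilon> (e / 2)"
  have d: "d > 0" "d \<le> \<epsilon>" "cball 0 d \<subseteq> ball (0 :: complex) e"
    using assms e by (auto simp: d_def)
  show ?thesis
  proof (rule that[OF d(1,2), of B])
    fix \<phi> :: "nat \<Rightarrow> complex \<Rightarrow> complex"
    assume "\<And>n. \<phi> n holomorphic_on ball 0 \<epsilon>"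
      "\<And>n w. w \<in> ball 0 \<epsilon> \<Longrightarrow> \<phi> n w \<noteq> 0 \<and> \<phi> n w \<noteq> 1" "\<And>n. cmod (\<phi> n 0) \<le> 1"
    then have X: "range \<phi> \<subseteq> X"
      by (auto simp: X_def)
    obtain g r where "strict_mono r"
      and lim: "\<And>K. compact K \<Longrightarrow> K \<subseteq> ball 0 e \<Longrightarrow> uniform_limit K (\<phi> \<circ> r) g sequentially"
    proof (rule Montel[of "ball 0 e" X \<phi>])
      show "h holomorphic_on ball 0 e" if "h \<in> X" for h
        using that e Z unfolding X_def by (blast intro: holomorphic_on_subset)
      show "\<exists>B. \<forall>h\<in>X. \<forall>z\<in>K. cmod (h z) \<le> B" if "compact K" "K \<subseteq> ball 0 e" for K
        using B e that by blast
    qed (use X in auto)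
    have "uniform_limit (ball 0 d) (\<phi> \<circ> r) g sequentially"
      using uniform_limit_on_subset[OF lim[OF compact_cball d(3)] ball_subset_cball] .
    moreover have "\<phi> n w \<in> cball 0 B" if "w \<in> ball 0 d" for n w
    proof -
      have "w \<in> Z"
        using that d(3) e(2) by (meson ball_subset_cball subsetD)
      then show ?thesis
        using B[OF subsetD[OF X rangeI]] by simp
    qed
    ultimately show "\<exists>r g. strict_mono r \<and> uniform_limit (ball 0 d) (\<lambda>n. \<phi> (r n)) g sequentially \<and>
         (\<forall>n. \<forall>w\<in>ball 0 d. \<phi> n w \<in> cball 0 B)"
      using \<open>strict_mono r\<close> by (auto simp: o_def)
  qed
qed

text \<open>\<open>three_point_map\<close> turns the family into functions omitting \<open>0\<close>
  and \<open>1\<close>. On the disc \<open>cball 0 B\<close> containing their values near the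
  centre, \<open>three_point_inv\<close> is uniformly continuous into the chordal metric and carries
  the convergence back.\<close>

lemma normal_family_omitting_three_points:
  assumes pqs: "distinct [p, q, s]" and "\<epsilon> > 0"
    and G: "\<And>g. g \<in> G \<Longrightarrow> \<exists>P. degree P > 0 \<and> g = poly_map P"
    and omit: "\<And>g w. g \<in> G \<Longrightarrow> w \<in> ball 0 \<epsilon> \<Longrightarrow> g (local_param x w) \<notin> {Some p, Some q, Some s}"
  obtains d where "d > 0" "normal_family_on (local_param x ` ball 0 d) G"
proof -
  obtain d B where d: "0 < d" "d \<le> \<epsilon>" and
    montel: "\<And>\<phi> :: nat \<Rightarrow> complex \<Rightarrow> complex. (\<And>n. \<phi> n holomorphic_on ball 0 \<epsilon>) \<Longrightarrow>
       (\<And>n w. w \<in> ball 0 \<epsilon> \<Longrightarrow> \<phi> n w \<noteq> 0 \<and> \<phi> n w \<noteq> 1) \<Longrightarrow> (\<And>n. cmod (\<phi> n 0) \<le> 1) \<Longrightarrow>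
       \<exists>r g. strict_mono r \<and> uniform_limit (ball 0 d) (\<lambda>n. \<phi> (r n)) g sequentially \<and>
         (\<forall>n. \<forall>w\<in>ball 0 d. \<phi> n w \<in> cball 0 B)"
    using montel_omitting_01[OF \<open>\<epsilon> > 0\<close>] by metis
  let ?U = "local_param x ` ball 0 d"
  have limit: "\<exists>(r :: nat \<Rightarrow> nat) h. strict_mono r \<and> uniform_limit ?U (\<lambda>n y. stereo (f (r n) y)) (\<lambda>y. stereo (h y)) sequentially"
    if f: "range f \<subseteq> G" and pqs: "distinct [p, q, s]"
      and omit: "\<And>g w. g \<in> G \<Longrightarrow> w \<in> ball 0 \<epsilon> \<Longrightarrow> g (local_param x w) \<notin> {Some p, Some q, Some s}"
      and le1: "\<And>n. cmod (three_point_map p q s (f n (local_param x 0))) \<le> 1"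
    for f :: "nat \<Rightarrow> sphere \<Rightarrow> sphere" and p q s
  proof -
    define \<phi> where "\<phi> = (\<lambda>n w. three_point_map p q s (f n (local_param x w)))"
    have hol: "\<phi> n holomorphic_on ball 0 \<epsilon>" for n
    proof -
      have "f n \<in> G"
        using f by auto
      then obtain P where "degree P > 0" "f n = poly_map P"
        using G by blast
      then show ?thesis
        using omit[OF \<open>f n \<in> G\<close>] pqs unfolding \<phi>_def by (auto intro!: holomorphic_three_point_map)
    qed
    obtain r g where r: "strict_mono r" and lim: "uniform_limit (ball 0 d) (\<lambda>n. \<phi> (r n)) g sequentially"
      and B: "\<And>n w. w \<in> ball 0 d \<Longrightarrow> \<phi> n w \<in> cball 0 B"
      using montel[of \<phi>, OF hol] three_point_map_omits[OF pqs omit] le1 f unfolding \<phi>_def by blast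
    let ?\<Psi> = "\<lambda>\<zeta>. stereo (three_point_inv p q s \<zeta>)"
    have "uniformly_continuous_on (cball 0 B) ?\<Psi>"
      by (intro compact_uniformly_continuous continuous_on_subset[OF continuous_stereo_three_point_inv[OF pqs]]) auto
    then have "uniform_limit (ball 0 d) (\<lambda>n w. ?\<Psi> (\<phi> (r n) w)) (\<lambda>w. ?\<Psi> (g w)) sequentially"
      using B by (intro uniform_limit_compose_uniformly_continuous_on[OF lim]) auto
    moreover have "three_point_inv p q s (\<phi> n w) = f n (local_param x w)" if "w \<in> ball 0 d" for n w
      unfolding \<phi>_def using omit[of "f n" w] that d f by (intro three_point_inv_map[OF pqs]) auto
    ultimately have "uniform_limit (ball 0 d) (\<lambda>n w. stereo (f (r n) (local_param x w))) (\<lambda>w. ?\<Psi> (g w)) sequentially"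
      by (simp add: uniform_limit_iff)
    then have "uniform_limit ?U (\<lambda>n y. stereo (f (r n) y)) (\<lambda>y. ?\<Psi> (g (local_coord x y))) sequentially"
      by (simp add: uniform_limit_iff local_coord_local_param)
    then show ?thesis
      using r by (intro exI[of _ r] exI[of _ "\<lambda>y. three_point_inv p q s (g (local_coord x y))"]) simp
  qed
  have "\<exists>(r :: nat \<Rightarrow> nat) h. strict_mono r \<and> uniform_limit ?U (\<lambda>n y. stereo (f (r n) y)) (\<lambda>y. stereo (h y)) sequentially"
    if f: "range f \<subseteq> G" for f :: "nat \<Rightarrow> sphere \<Rightarrow> sphere"
  proof -
    \<comment> \<open>Infinitely many centre values have modulus at most \<open>1\<close>, or
      infinitely many have modulus above \<open>1\<close>; in the latter case exchanging
      \<open>p\<close> and \<open>q\<close> inverts them.\<close>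
    have "\<exists>p q s (r1 :: nat \<Rightarrow> nat). strict_mono r1 \<and> distinct [p, q, s] \<and>
      (\<forall>g w. g \<in> G \<longrightarrow> w \<in> ball 0 \<epsilon> \<longrightarrow> g (local_param x w) \<notin> {Some p, Some q, Some s}) \<and>
      (\<forall>n. cmod (three_point_map p q s (f (r1 n) (local_param x 0))) \<le> 1)"
    proof (cases "infinite {n. cmod (three_point_map p q s (f n (local_param x 0))) \<le> 1}")
      case True
      then show ?thesis
        using infinite_enumerate[OF True] pqs omit by (metis (no_types, lifting) mem_Collect_eq)
    next
      case False
      then have "infinite (- {n. cmod (three_point_map p q s (f n (local_param x 0))) \<le> 1})" (is "infinite ?N")
        by (metis finite_compl infinite_UNIV_nat)
      then obtain r1 :: "nat \<Rightarrow> nat" where r1: "strict_mono r1" "\<And>n. \<not> cmod (three_point_map p q s (f (r1 n) (local_param x 0))) \<le> 1"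
        using infinite_enumerate[of ?N] by auto
      then have "cmod (three_point_map q p s (f (r1 n) (local_param x 0))) \<le> 1" for n
      proof -
        have "1 \<le> cmod (three_point_map p q s (f (r1 n) (local_param x 0)))"
          using r1(2)[of n] by linarith
        then show ?thesis
          unfolding three_point_map_swap[of q] norm_inverse by (simp add: inverse_le_1_iff)
      qed
      then show ?thesis
        using r1 pqs omit by (intro exI[of _ q] exI[of _ p] exI[of _ s] exI[of _ r1]) auto
    qed
    then obtain p' q' s' and r1 :: "nat \<Rightarrow> nat" where r1: "strict_mono r1" "distinct [p', q', s']"
      "\<And>g w. g \<in> G \<Longrightarrow> w \<in> ball 0 \<epsilon> \<Longrightarrow> g (local_param x w) \<notin> {Some p', Some q', Some s'}"
      "\<And>n. cmod (three_point_map p' q' s' (f (r1 n) (local_param x 0))) \<le> 1"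
      by blast
    have "range (\<lambda>n. f (r1 n)) \<subseteq> G"
      using f by auto
    then have "\<exists>(r :: nat \<Rightarrow> nat) h. strict_mono r \<and>
        uniform_limit ?U (\<lambda>n y. stereo (f (r1 (r n)) y)) (\<lambda>y. stereo (h y)) sequentially"
      by (rule limit) (fact r1)+
    then obtain r :: "nat \<Rightarrow> nat" and h where r: "strict_mono r"
      "uniform_limit ?U (\<lambda>n y. stereo (f (r1 (r n)) y)) (\<lambda>y. stereo (h y)) sequentially"
      by blast
    have "strict_mono (r1 \<circ> r)"
      using r1(1) r(1) by (rule strict_mono_o)
    then show ?thesis
      using r(2) by (intro exI[of _ "r1 \<circ> r"] exI[of _ h]) simp
  qed
  then have "normal_family_on ?U G"
    unfolding normal_family_on_def by (meson uniform_limit_on_subset)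
  then show ?thesis
    using that d(1) by blast
qed

subsection \<open>The Julia set\<close>

lemma poly_map_pcompose:
  fixes p q :: "complex poly"
  assumes "degree p > 0" "degree q > 0"
  shows "poly_map (p \<circ>\<^sub>p q) = poly_map p \<circ> poly_map q"
  using assms by (auto simp: poly_map_def fun_eq_iff degree_pcompose poly_pcompose split: option.splits)

lemma filled_eq_vimage: "filled h f = poly f -` filled h [:0, 1:]"
  using iterp_pcompose[of h _ "[:0, 1:]" f] by (auto simp: filled_def pcompose_pCons poly_pcompose)

text \<open>A non-constant polynomial is continuous and open, so taking preimages commutes with
  taking interiors.\<close>

lemma frontier_filled_eq_vimage:
  assumes "degree h = 2" "degree f > 0"
  shows "frontier (filled h f) = poly f -` frontier (filled h [:0, 1:])"
proof -
  let ?K = "filled h [:0, 1:]"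
  have "interior (poly f -` ?K) = poly f -` interior ?K"
  proof
    have "open (poly f ` interior (poly f -` ?K))"
    proof (rule open_mapping_thm)
      show "\<not> poly f constant_on UNIV"
        using constant_degree[of f] assms(2) by (simp add: constant_on_def constant_def) metis
    qed (auto intro: holomorphic_intros)
    moreover have "poly f ` interior (poly f -` ?K) \<subseteq> ?K"
      using interior_subset by fastforce
    ultimately show "interior (poly f -` ?K) \<subseteq> poly f -` interior ?K"
      using interior_maximal by blast
    show "poly f -` interior ?K \<subseteq> interior (poly f -` ?K)"
    proof (rule interior_maximal)
      show "open (poly f -` interior ?K)"
        by (intro open_vimage continuous_intros) auto
    qed (use interior_subset in fastforce)
  qed
  moreover have "closed (filled h f)" "closed ?K"
    using assms by (auto intro!: compact_imp_closed compact_filled)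
  ultimately show ?thesis
    by (simp add: frontier_def filled_eq_vimage[of h f] vimage_Diff)
qed

text \<open>The spherical height \<open>snd (stereo x)\<close> is bounded away from \<open>1\<close> on the filled set and tends
  along the iterates to \<open>1\<close> off it, so no limit function can be continuous at a frontier point.\<close>

lemma frontier_filled_not_normal:
  assumes h: "degree h = 2" and f: "degree f > 0" and z: "z \<in> frontier (filled h f)"
    and U: "openin riemann_sphere U" "Some z \<in> U"
    and G: "\<And>n. poly_map (iterp h (Suc n) f) \<in> G"
  shows "\<not> normal_family_on U G"
proof
  assume normal: "normal_family_on U G"
  have "open {w. Some w \<in> U}"
    using openin_continuous_map_preimage[OF continuous_map_Some U(1)] by simp
  then obtain e where e: "e > 0" "cball z e \<subseteq> {w. Some w \<in> U}"
    using U(2) open_contains_cball by blast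
  \<comment> \<open>At least one factor \<open>h\<close> is applied, since \<open>f\<close> may be
    the identity, which need not lie in \<open>G\<close>.\<close>
  define F where "F = (\<lambda>n. iterp h (Suc n) f)"
  obtain r l where r: "strict_mono r" and lim: "\<And>K. compactin riemann_sphere K \<Longrightarrow> K \<subseteq> U \<Longrightarrow>
      uniform_limit K (\<lambda>n x. stereo (poly_map (F (r n)) x)) (\<lambda>x. stereo (l x)) sequentially"
    using normal[unfolded normal_family_on_def, rule_format, of "\<lambda>n. poly_map (F n)"] G
    unfolding F_def by blast
  define t where "t = (\<lambda>n w. snd (stereo (poly_map (F n) (Some w))))"
  have t: "t n w = 1 - 2 / ((cmod (poly (F n) w))\<^sup>2 + 1)" for n w
  proof -
    have "(cmod (poly (F n) w))\<^sup>2 + 1 \<noteq> 0"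
      by (metis add_nonneg_pos less_irrefl zero_le_power2 zero_less_one)
    then show ?thesis
      by (simp add: t_def stereo_def poly_map_def field_simps)
  qed
  obtain \<rho> where \<rho>: "escape_radius h \<rho>"
    using escape_radius_exists h by blast
  \<comment> \<open>Heights on the filled set are at most \<open>1 - 4 * \<eta>\<close>. Off it, a
    height above \<open>1 - \<eta>\<close> at a late stage and two uniform errors below
    \<open>\<eta>\<close> leave more than \<open>1 - 3 * \<eta>\<close> at stage
    \<open>N\<close>.\<close>
  define \<eta> where "\<eta> = 1 / (2 * (\<rho>\<^sup>2 + 1))"
  have "\<rho>\<^sup>2 + 1 > 0"
    by (metis add_nonneg_pos zero_le_power2 zero_less_one)
  then have "\<eta> > 0"
    by (simp add: \<eta>_def)
  have "compactin riemann_sphere (Some ` cball z e)"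
    by (rule image_compactin[OF _ continuous_map_Some]) simp
  then have "uniform_limit (Some ` cball z e) (\<lambda>n x. stereo (poly_map (F (r n)) x)) (\<lambda>x. stereo (l x)) sequentially"
    using e by (intro lim) auto
  then obtain N where N: "\<And>n w. n \<ge> N \<Longrightarrow> w \<in> cball z e \<Longrightarrow>
      dist (stereo (poly_map (F (r n)) (Some w))) (stereo (l (Some w))) < \<eta>"
    using \<open>\<eta> > 0\<close> unfolding uniform_limit_sequentially_iff by (metis imageI)
  have N': "\<bar>t (r n) w - snd (stereo (l (Some w)))\<bar> < \<eta>" if "n \<ge> N" "w \<in> cball z e" for n w
    using N[OF that] dist_snd_le[of "stereo (poly_map (F (r n)) (Some w))" "stereo (l (Some w))"]
    by (simp add: t_def dist_real_def)
  have outside: "t (r N) y > 1 - 3 * \<eta>" if y: "y \<in> cball z e" "y \<notin> filled h f" for y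
  proof -
    obtain m where "\<rho> < cmod (poly (iterp h m f) y)"
      using y filled_eq[OF \<rho>] by (auto simp: not_le)
    then have inf: "filterlim (\<lambda>n. cmod (poly (iterp h n f) y)) at_top sequentially"
      by (rule escape_tendsto_infinity[OF \<rho>])
    have "filterlim (\<lambda>n. Suc (r n)) at_top sequentially"
      using r by (intro filterlim_subseq) (simp add: strict_mono_def)
    from filterlim_compose[OF inf this]
    have "filterlim (\<lambda>n. cmod (poly (F (r n)) y)) at_top sequentially"
      by (simp add: F_def)
    then have "\<forall>\<^sub>F n in sequentially. cmod (poly (F (r n)) y) \<ge> max 1 (2 / \<eta>)"
      unfolding filterlim_at_top by blast
    then obtain n where n: "n \<ge> N" "cmod (poly (F (r n)) y) \<ge> 1" "cmod (poly (F (r n)) y) \<ge> 2 / \<eta>"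
      using eventually_happens'[OF sequentially_bot eventually_conj[OF _ eventually_ge_at_top[of N]]] by force
    have "2 / \<eta> < (cmod (poly (F (r n)) y))\<^sup>2 + 1"
      using n(3) self_le_power[OF n(2), of 2] by simp
    then have "2 / ((cmod (poly (F (r n)) y))\<^sup>2 + 1) < \<eta>"
    proof -
      have pos: "(cmod (poly (F (r n)) y))\<^sup>2 + 1 > 0"
        by (intro add_nonneg_pos) auto
      show ?thesis
        using \<open>2 / \<eta> < _\<close> \<open>\<eta> > 0\<close> unfolding pos_divide_less_eq[OF pos] pos_divide_less_eq[OF \<open>\<eta> > 0\<close>]
        by (simp only: mult.commute)
    qed
    then have "t (r n) y > 1 - \<eta>"
      unfolding t by simp
    then show ?thesis
      using N'[OF n(1) y(1)] N'[OF order_refl y(1)] by linarith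
  qed
  have "t (r N) z \<ge> 1 - 3 * \<eta>"
  proof -
    \<comment> \<open>The bound \<open>outside\<close> holds only near \<open>z\<close>; adding the
      exterior of the ball gives a closed set containing the whole complement of the filled
      set.\<close>
    define T where "T = {w. 1 - 3 * \<eta> \<le> t (r N) w} \<union> - ball z e"
    have "closed {w. 1 - 3 * \<eta> \<le> t (r N) w}"
      unfolding t by (intro closed_Collect_le continuous_intros)
        (metis add_nonneg_pos less_irrefl zero_le_power2 zero_less_one)
    then have "closed T"
      by (auto simp: T_def)
    moreover have "- filled h f \<subseteq> T"
      using outside by (force simp: T_def)
    ultimately have "closure (- filled h f) \<subseteq> T"
      by (rule closure_minimal[rotated])
    then show ?thesis
      using z e(1) by (auto simp: T_def frontier_closures)
  qed
  moreover have "t (r N) z \<le> 1 - 4 * \<eta>"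
  proof -
    have "z \<in> filled h f"
      using z compact_imp_closed[OF compact_filled[OF h f]] by (simp add: frontier_def)
    then have "cmod (poly (F (r N)) z) \<le> \<rho>"
      unfolding F_def using filled_eq[OF \<rho>] by blast
    then have "(cmod (poly (F (r N)) z))\<^sup>2 + 1 \<le> \<rho>\<^sup>2 + 1"
      by (simp add: power_mono)
    then have "2 / (\<rho>\<^sup>2 + 1) \<le> 2 / ((cmod (poly (F (r N)) z))\<^sup>2 + 1)"
      by (intro divide_left_mono) (auto intro!: mult_pos_pos add_nonneg_pos)
    moreover have "4 * \<eta> = 2 / (\<rho>\<^sup>2 + 1)"
      using \<open>\<rho>\<^sup>2 + 1 > 0\<close> by (simp add: \<eta>_def field_simps)
    ultimately show ?thesis
      unfolding t by linarith
  qed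
  ultimately show False
    using \<open>\<eta> > 0\<close> by simp
qed

lemma openin_Fatou: "openin riemann_sphere (Fatou G)"
proof (subst openin_subopen, intro ballI)
  fix x assume "x \<in> Fatou G"
  then obtain U where "openin riemann_sphere U" "x \<in> U" "normal_family_on U G"
    by (auto simp: Fatou_def)
  then show "\<exists>T. openin riemann_sphere T \<and> x \<in> T \<and> T \<subseteq> Fatou G"
    by (auto simp: Fatou_def)
qed

lemma topspace_riemann_sphere: "topspace riemann_sphere = UNIV"
  by (auto simp: image_iff)

lemma closedin_Julia: "closedin riemann_sphere (Julia G)"
  using openin_Fatou[of G] unfolding Julia_def topspace_riemann_sphere[symmetric] by blast

section \<open>The semigroup as non-empty words, and its critical orbits\<close>

lemma comp_semigroup_words:
  assumes "\<And>h. h \<in> \<Gamma> \<Longrightarrow> degree h = 2"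
  shows "comp_semigroup (poly_map ` \<Gamma>) = (\<lambda>ws. poly_map (word ws)) ` (lists \<Gamma> - {[]})" (is "?G = ?W")
proof
  have deg: "degree (word ws) > 0" if "ws \<in> lists \<Gamma>" for ws
    using that assms by (induction ws) (auto simp: degree_pcompose)
  show "?G \<subseteq> ?W"
  proof
    fix g assume "g \<in> ?G"
    then show "g \<in> ?W"
    proof induction
      case (generator f)
      then obtain h where "h \<in> \<Gamma>" "f = poly_map h"
        by blast
      then show ?case
        by (intro image_eqI[of _ _ "[h]"]) auto
    next
      case (comp f g)
      then obtain us ws where "us \<in> lists \<Gamma> - {[]}" "ws \<in> lists \<Gamma> - {[]}"
        "f = poly_map (word us)" "g = poly_map (word ws)"
        by blast
      then show ?case
        using deg by (intro image_eqI[of _ _ "us @ ws"]) (auto simp: word_append poly_map_pcompose)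
    qed
  qed
  have "poly_map (word ws) \<in> ?G" if "ws \<in> lists \<Gamma>" "ws \<noteq> []" for ws
    using that(2,1)
  proof (induction ws rule: list_nonempty_induct)
    case (single h)
    then show ?case
      by (auto intro: comp_semigroup.generator)
  next
    case (cons h ws)
    then have "poly_map h \<in> ?G" "poly_map (word ws) \<in> ?G"
      by (auto intro: comp_semigroup.generator)
    then have "poly_map h \<circ> poly_map (word ws) \<in> ?G"
      by (rule comp_semigroup.comp)
    moreover have "poly_map (word (h # ws)) = poly_map h \<circ> poly_map (word ws)"
      unfolding word_Cons using deg[of ws] assms[of h] cons.prems by (intro poly_map_pcompose) auto
    ultimately show ?case
      by (simp only:)
  qed
  then show "?W \<subseteq> ?G"
    by blast
qed

text \<open>The letter \<open>h\<close> acts first, and its expansion at \<open>crit h\<close> has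
  no linear term.\<close>

lemma critical_point_word:
  assumes "degree h = 2"
  shows "critical_point (poly_map (word (ws @ [h]))) (Some (crit h))"
proof -
  have "local_coord (poly_map (word (ws @ [h])) (Some (crit h)))
      (poly_map (word (ws @ [h])) (local_param (Some (crit h)) w))
    = poly (word ws) (coeff h 2 * w\<^sup>2 + poly h (crit h)) - poly (word ws) (poly h (crit h))" for w
    using quadratic_coeffs(2)[OF assms, of "crit h + w"]
    by (simp add: local_coord_def local_param_def poly_map_def word_append poly_pcompose)
  then show ?thesis
    unfolding critical_point_def by (auto intro!: derivative_eq_intros)
qed

lemma pcb_critical_orbits:
  assumes G: "G \<in> pcb_semigroups" "G = comp_semigroup (poly_map ` \<Gamma>)"
    and deg: "\<And>h. h \<in> \<Gamma> \<Longrightarrow> degree h = 2"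
  obtains R where "postcritically_bounded_quadratics \<Gamma> R"
proof -
  obtain R where R: "\<And>z. Some z \<in> finite_postcritical_set G \<Longrightarrow> cmod z \<le> R"
    using G(1) unfolding pcb_semigroups_def bounded_iff by blast
  have "cmod (poly (word ws) (poly h (crit h))) \<le> R" if "h \<in> \<Gamma>" "ws \<in> lists \<Gamma>" for h ws
  proof (rule R)
    let ?g = "poly_map (word (ws @ [h]))"
    have "ws @ [h] \<in> lists \<Gamma> - {[]}"
      using that by auto
    then have "?g \<in> G"
      unfolding G(2) by (subst comp_semigroup_words) (auto intro: deg)
    moreover have "?g (Some (crit h)) = Some (poly (word ws) (poly h (crit h)))"
      by (simp add: poly_map_def word_append poly_pcompose)
    ultimately have "Some (poly (word ws) (poly h (crit h))) \<in> (\<Union>g\<in>G. critical_values g)"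
      using critical_point_word[OF deg[OF that(1)], of ws] unfolding critical_values_def
      by (metis (mono_tags, lifting) UN_I imageI mem_Collect_eq)
    then show "Some (poly (word ws) (poly h (crit h))) \<in> finite_postcritical_set G"
      unfolding finite_postcritical_set_def postcritical_set_def
      using closure_of_subset[of "\<Union>g\<in>G. critical_values g" riemann_sphere]
      unfolding topspace_riemann_sphere by blast
  qed
  then have "postcritically_bounded_quadratics \<Gamma> R"
    using deg by unfold_locales
  then show ?thesis
    by (rule that)
qed

context postcritically_bounded_quadratics
begin

lemma semigroup_eq: "comp_semigroup (poly_map ` \<Gamma>) = (\<lambda>ws. poly_map (word ws)) ` (lists \<Gamma> - {[]})"
  by (rule comp_semigroup_words) (rule degree_2)

text \<open>This supplies three values to omit. A finite connected frontier is one point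
  \<open>a\<close>; as the punctured plane is connected and the filled set bounded, the filled set
  is \<open>{a}\<close>. Then \<open>a\<close> is a fixed critical point, but a second fixed point
  also has a bounded orbit.\<close>

lemma infinite_frontier_filled:
  assumes h: "h \<in> \<Gamma>"
  shows "infinite (frontier (filled h [:0, 1:]))"
proof
  let ?K = "filled h [:0, 1:]"
  assume "finite (frontier ?K)"
  moreover have "connected (frontier ?K)" "frontier ?K \<noteq> {}"
    using connected_frontier_filled[OF h, of "[]"] frontier_filled_nonempty[OF h, of "[]"] by auto
  ultimately obtain a where a: "frontier ?K = {a}"
    using connected_finite_iff_sing by blast
  have inv: "poly h y \<in> ?K \<longleftrightarrow> y \<in> ?K" for y
    using filled_eq_vimage[of h h] filled_pcompose_self[of h "[:0, 1:]"] by auto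
  have cv: "poly h (crit h) \<in> ?K"
    using critical_value_in_filled[OF h h, of "[]"] by simp
  have "- {a} - ?K \<noteq> {}"
  proof
    assume "- {a} - ?K = {}"
    then have "UNIV = insert a ?K"
      by blast
    then show False
      using compact_imp_bounded[OF compact_filled_word[OF h, of "[]"]] not_bounded_UNIV
      by (metis bounded_insert lists.Nil word_Nil)
  qed
  moreover have "connected (- {a})"
    by (rule connected_punctured_universe) simp
  ultimately have "?K \<subseteq> {a}"
    using connected_Int_frontier[of "- {a}" ?K] a by blast
  then have "poly h (crit h) = a" "crit h = a"
    using cv inv by auto
  \<comment> \<open>The other solution of \<open>a + c * (z - a)^2 = z\<close> with
    \<open>c = coeff h 2\<close>.\<close>
  moreover define b where "b = a + 1 / coeff h 2"
  moreover have "coeff h 2 \<noteq> 0"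
    using quadratic_coeffs(1) degree_2 h by blast
  ultimately have fixed: "poly h b = b" and "b \<noteq> a"
    using quadratic_coeffs(2)[of h b] degree_2[OF h] by (auto simp: power2_eq_square)
  have "poly (iterp h n [:0, 1:]) b = b" for n
    by (induction n) (simp_all add: iterp_Suc poly_pcompose fixed)
  then have "b \<in> ?K"
    by (simp add: filled_def)
  then show False
    using \<open>?K \<subseteq> {a}\<close> \<open>b \<noteq> a\<close> by blast
qed

lemma frontier_filled_subset_Julia:
  assumes "h \<in> \<Gamma>" "ws \<in> lists \<Gamma>"
  shows "Some ` frontier (filled h (word ws)) \<subseteq> Julia (comp_semigroup (poly_map ` \<Gamma>))"
proof -
  have "poly_map (iterp h (Suc n) (word ws)) \<in> comp_semigroup (poly_map ` \<Gamma>)" for n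
    unfolding semigroup_eq iterp_word
    using replicate_in_lists[OF assms, of "Suc n"] by (intro imageI) simp
  then show ?thesis
    using frontier_filled_not_normal[OF degree_2[OF assms(1)] degree_word_pos[OF assms(2)]]
    unfolding Julia_def Fatou_def by blast
qed

text \<open>On a disc avoiding \<open>E\<close> no element of the semigroup takes a value in the
  frontier of the filled Julia set of \<open>h\<close>, because the preimages of that frontier lie
  in \<open>E\<close>. Omitting three of its points makes the family normal there.\<close>

lemma Julia_subset_closed:
  assumes h: "h \<in> \<Gamma>" and E: "closedin riemann_sphere E"
    and sub: "\<And>ws. ws \<in> lists \<Gamma> \<Longrightarrow> Some ` frontier (filled h (word ws)) \<subseteq> E"
  shows "Julia (comp_semigroup (poly_map ` \<Gamma>)) \<subseteq> E"
proof
  let ?G = "comp_semigroup (poly_map ` \<Gamma>)"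
  fix x assume x: "x \<in> Julia ?G"
  show "x \<in> E"
  proof (rule ccontr)
    assume "x \<notin> E"
    moreover have "openin riemann_sphere (- E)"
      using E unfolding closedin_def topspace_riemann_sphere Compl_eq_Diff_UNIV by blast
    ultimately obtain \<epsilon> where \<epsilon>: "\<epsilon> > 0" "local_param x ` ball 0 \<epsilon> \<subseteq> - E"
      using local_param_ball_subset by (metis ComplI)
    obtain T where "T \<subseteq> frontier (filled h [:0, 1:])" "card T = 3"
      using infinite_arbitrarily_large[OF infinite_frontier_filled[OF h]] by blast
    then obtain p q s where pqs: "distinct [p, q, s]" "{p, q, s} \<subseteq> frontier (filled h [:0, 1:])"
      by (auto simp: card_3_iff)
    have omit: "g (local_param x w) \<notin> {Some p, Some q, Some s}" if "g \<in> ?G" "w \<in> ball 0 \<epsilon>" for g w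
    proof
      assume *: "g (local_param x w) \<in> {Some p, Some q, Some s}"
      obtain ws where ws: "ws \<in> lists \<Gamma>" "g = poly_map (word ws)"
        using \<open>g \<in> ?G\<close> semigroup_eq by auto
      then obtain y where y: "local_param x w = Some y"
        using * degree_word_pos[OF ws(1)] by (cases "local_param x w") (auto simp: poly_map_def)
      then have "poly (word ws) y \<in> frontier (filled h [:0, 1:])"
        using * pqs(2) ws by (auto simp: poly_map_def)
      then have "y \<in> frontier (filled h (word ws))"
        using frontier_filled_eq_vimage[OF degree_2[OF h] degree_word_pos[OF ws(1)]] by simp
      then have "local_param x w \<in> E"
        using sub[OF ws(1)] y by auto
      then show False
        using \<epsilon>(2) \<open>w \<in> ball 0 \<epsilon>\<close> by blast
    qed
    have poly: "\<exists>P. degree P > 0 \<and> g = poly_map P" if "g \<in> ?G" for g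
    proof -
      obtain ws where "ws \<in> lists \<Gamma>" "g = poly_map (word ws)"
        using \<open>g \<in> ?G\<close> semigroup_eq by auto
      then show ?thesis
        using degree_word_pos by blast
    qed
    obtain d where d: "d > 0" "normal_family_on (local_param x ` ball 0 d) ?G"
      by (rule normal_family_omitting_three_points[OF pqs(1) \<epsilon>(1), of ?G x]) (use poly omit in blast)+
    have "x \<in> local_param x ` ball 0 d"
      using d(1) by (intro image_eqI[of _ _ 0]) (auto simp: local_param_def split: option.splits)
    then have "x \<in> Fatou ?G"
      using openin_local_param_ball[OF d(1), of x] d(2) unfolding Fatou_def by blast
    then show False
      using x by (simp add: Julia_def)
  qed
qed

lemma connectedin_Julia: "connectedin riemann_sphere (Julia (comp_semigroup (poly_map ` \<Gamma>)))"
proof (cases "\<Gamma> = {}")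
  case True
  \<comment> \<open>Without generators the family is empty, hence vacuously normal
    everywhere.\<close>
  have "comp_semigroup (poly_map ` \<Gamma>) = {}"
    using semigroup_eq True by auto
  then have "normal_family_on UNIV (comp_semigroup (poly_map ` \<Gamma>))"
    by (simp add: normal_family_on_def)
  then have "Julia (comp_semigroup (poly_map ` \<Gamma>)) = {}"
    using openin_topspace[of riemann_sphere] unfolding topspace_riemann_sphere Julia_def Fatou_def by blast
  then show ?thesis
    by simp
next
  case False
  let ?J = "Julia (comp_semigroup (poly_map ` \<Gamma>))"
  obtain h0 where h0: "h0 \<in> \<Gamma>"
    using False by blast
  have no_sep: False if E: "closedin riemann_sphere E1" "closedin riemann_sphere E2"
    and cov: "?J \<subseteq> E1 \<union> E2" and disj: "E1 \<inter> E2 \<inter> ?J = {}" and ne: "E2 \<inter> ?J \<noteq> {}"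
    and side: "Some ` frontier (filled h0 (word [])) \<subseteq> E1" for E1 E2
  proof -
    \<comment> \<open>Only finite points enter \<open>A\<close> and \<open>B\<close>; a possible
      point at infinity of the Julia set is recovered by \<open>Julia_subset_closed\<close>, since
      \<open>E1\<close> is closed in the sphere.\<close>
    define A where "A = {z. Some z \<in> E1 \<inter> ?J}"
    define B where "B = {z. Some z \<in> E2 \<inter> ?J}"
    have "closed A" "closed B"
      unfolding A_def B_def
      using closedin_continuous_map_preimage[OF continuous_map_Some closedin_Int[OF E(1) closedin_Julia]]
        closedin_continuous_map_preimage[OF continuous_map_Some closedin_Int[OF E(2) closedin_Julia]]
      by auto
    moreover have "A \<inter> B = {}"
      using disj by (auto simp: A_def B_def)
    moreover have "frontier (filled h (word ws)) \<subseteq> A \<union> B" if "h \<in> \<Gamma>" "ws \<in> lists \<Gamma>" for h ws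
      using frontier_filled_subset_Julia[OF that] cov by (auto simp: A_def B_def)
    moreover have "frontier (filled h0 (word [])) \<subseteq> A"
      using side frontier_filled_subset_Julia[OF h0, of "[]"] by (auto simp: A_def)
    ultimately have "frontier (filled h0 (word ws)) \<subseteq> A" if "ws \<in> lists \<Gamma>" for ws
      using all_same_side[of A B h0 h0 ws] h0 that by blast
    then have "?J \<subseteq> E1"
      by (intro Julia_subset_closed[OF h0 E(1)]) (auto simp: A_def)
    then show False
      using disj ne by blast
  qed
  show ?thesis
    unfolding connectedin_closedin
  proof (intro conjI notI, goal_cases)
    case 1
    then show ?case
      by (simp only: topspace_riemann_sphere subset_UNIV)
  next
    case 2
    then obtain E1 E2 where E: "closedin riemann_sphere E1" "closedin riemann_sphere E2"
      "?J \<subseteq> E1 \<union> E2" "E1 \<inter> E2 \<inter> ?J = {}" "E1 \<inter> ?J \<noteq> {}" "E2 \<inter> ?J \<noteq> {}"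
      by blast
    let ?L = "frontier (filled h0 (word []))"
    have conn: "connectedin riemann_sphere (Some ` ?L)"
      using connected_frontier_filled[OF h0, of "[]"]
      by (intro connectedin_continuous_map_image[OF continuous_map_Some]) (simp add: connectedin_iff_connected)
    have LJ: "Some ` ?L \<subseteq> ?J"
      using frontier_filled_subset_Julia[OF h0, of "[]"] by simp
    have "Some ` ?L \<subseteq> E1 \<or> Some ` ?L \<subseteq> E2"
    proof (rule ccontr)
      assume "\<not> ?thesis"
      then have "E1 \<inter> Some ` ?L \<noteq> {}" "E2 \<inter> Some ` ?L \<noteq> {}"
        using LJ E(3) by blast+
      moreover have "Some ` ?L \<subseteq> E1 \<union> E2" "E1 \<inter> E2 \<inter> Some ` ?L = {}"
        using LJ E(3,4) by blast+
      ultimately show False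
        using conn E(1,2) unfolding connectedin_closedin by blast
    qed
    then show False
      using no_sep[OF E(1,2,3,4,6)] no_sep[OF E(2,1) _ _ E(5)] E(3,4) by (auto simp: Un_commute Int_commute)
  qed
qed

end

theorem theorem2p15:
  fixes G :: "(sphere \<Rightarrow> sphere) set" and \<Gamma> :: "complex poly set"
  assumes "G \<in> pcb_semigroups"
    and "G = comp_semigroup (poly_map ` \<Gamma>)"
    and "\<forall>p\<in>\<Gamma>. degree p = 2"
  shows "connectedin riemann_sphere (Julia G)"
proof -
  obtain R where "postcritically_bounded_quadratics \<Gamma> R"
    using pcb_critical_orbits[OF assms(1,2)] assms(3) by blast
  then show ?thesis
    unfolding assms(2) by (rule postcritically_bounded_quadratics.connectedin_Julia)
qed

end
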